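(* Let $\Sigma$ be a linear switched system with modes $(A_i,B_i,C_i,D_i)$, $i=1,\dots,\ell$, let $\Sigma_{\mathrm E}=(A_{\mathrm E},B_{\mathrm E},C_{\mathrm E},D_{\mathrm E})$ be an envelope system for $\Sigma$, and let the matrix functions $K(\sigma),K_0(\sigma),C_0(\sigma)$ be as defined in the context. For a given input $\boldsymbol u$, let $\boldsymbol y(t;\boldsymbol u)$ denote the output of $\Sigma$ with input $\boldsymbol u$, and for an input $\boldsymbol u_{\mathrm E}$ let $\boldsymbol y_{\mathrm E}(t;\boldsymbol u_{\mathrm E})$ denote the output of $\Sigma_{\mathrm E}$ with input $\boldsymbol u_{\mathrm E}$ (zero initial states in both cases). Then $$\boldsymbol y(t;\boldsymbol u)=C_0(\sigma)\,\boldsymbol y_{\mathrm E}\bigl(t;\,K(\sigma)\boldsymbol y_{\mathrm E}+K_0(\sigma)\boldsymbol u\bigr),\qquad t\ge 0,$$ that is, the envelope system in closed loop with the feedback law $\boldsymbol u_{\mathrm E}(t)=K(\sigma)\boldsymbol y_{\mathrm E}(t)+K_0(\sigma)\boldsymbol u(t)$ reproduces, after multiplication of its output by $C_0(\sigma)$, the output of the switched system.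
   Context: **Switched system.** $\Sigma$ is the system $$\dot{\boldsymbol x}(t)=A_\sigma \boldsymbol x(t)+B_\sigma \boldsymbol u(t),\quad \boldsymbol y(t)=C_\sigma \boldsymbol x(t)+D_\sigma \boldsymbol u(t),\quad \boldsymbol x(0)=0,\quad t\ge 0,$$ with $A_i\in\mathbb R^{n\times n}$, $B_i\in\mathbb R^{n\times m}$, $C_i\in\mathbb R^{p\times n}$, $D_i\in\mathbb R^{p\times m}$ for $i=1,\dots,\ell$. The switching signal may depend on time and on the output, $\sigma:[0,\infty)\times\mathbb R^p\to\{1,\dots,\ell\}$. Below, $\sigma=\sigma(t)$ denotes the mode active at time $t$ along the trajectory of $\Sigma$ under consideration (so $\sigma(t)=\sigma(t,\boldsymbol y(t))$ when the switching law is output-dependent). It is piecewise constant with switching times $0=t_0<t_1<\dots<t_s$. The same active-mode function is used in the feedback for the envelope system. **Differences of modes.** For $i=2,\dots,\ell$ put $\Delta_{A,i}=A_1-A_i$, $\Delta_{B,i}=B_1-B_i$, $\Delta_{C,i}=C_1-C_i$, $\Delta_{D,i}=D_1-D_i$. Let $\beta_i=\operatorname{rank}(\Delta_{A,i})$ and fix any decomposition $\Delta_{A,i}=S_iM_iT_i^T$ with $S_i,T_i\in\mathbb R^{n\times\beta_i}$, $M_i\in\mathbb R^{\beta_i\times\beta_i}$. Put $\mathfrak L=\sum_{i=2}^{\ell}\beta_i$, $m_{\mathrm E}=\ell m+\mathfrak L$, $p_{\mathrm E}=\ell p+\mathfrak L$. **Envelope system.** $\Sigma_{\mathrm E}$ is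 the non-switched linear system $\dot{\boldsymbol x}_{\mathrm E}=A_{\mathrm E}\boldsymbol x_{\mathrm E}+B_{\mathrm E}\boldsymbol u_{\mathrm E}$, $\boldsymbol y_{\mathrm E}=C_{\mathrm E}\boldsymbol x_{\mathrm E}+D_{\mathrm E}\boldsymbol u_{\mathrm E}$, $\boldsymbol x_{\mathrm E}(0)=0$, with $$A_{\mathrm E}=A_1\in\mathbb R^{n\times n},\qquad B_{\mathrm E}=\begin{bmatrix}B_1&\Delta_{B,2}&\cdots&\Delta_{B,\ell}&S_2&\cdots&S_\ell\end{bmatrix}\in\mathbb R^{n\times m_{\mathrm E}},$$ $$C_{\mathrm E}^T=\begin{bmatrix}C_1^T&\Delta_{C,2}^T&\cdots&\Delta_{C,\ell}^T&T_2&\cdots&T_\ell\end{bmatrix}\in\mathbb R^{n\times p_{\mathrm E}},$$ $$D_{\mathrm E}=\operatorname{blkdiag}(D_1,-\Delta_{D,2},\dots,-\Delta_{D,\ell},0_{\mathfrak L,\mathfrak L})\in\mathbb R^{p_{\mathrm E}\times m_{\mathrm E}}.$$ **Feedback matrices.** With the Kronecker delta $\delta_{i,\sigma}$, $$K(\sigma)=\operatorname{blkdiag}(0_{\ell m,\ell p},-\delta_{2,\sigma}M_2,\dots,-\delta_{\ell,\sigma}M_\ell)\in\mathbb R^{m_{\mathrm E}\times p_{\mathrm E}},$$ $$K_0(\sigma)=\begin{bmatrix}I_m&-\delta_{2,\sigma}I_m&\cdots&-\delta_{\ell,\sigma}I_m&0_{m,\mathfrak L}\end{bmatrix}^T\in\mathbb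 R^{m_{\mathrm E}\times m},$$ $$C_0(\sigma)=\begin{bmatrix}I_p&-\delta_{2,\sigma}I_p&\cdots&-\delta_{\ell,\sigma}I_p&0_{p,\mathfrak L}\end{bmatrix}\in\mathbb R^{p\times p_{\mathrm E}}.$$ The notation $\boldsymbol y_{\mathrm E}(t;K(\sigma)\boldsymbol y_{\mathrm E}+K_0(\sigma)\boldsymbol u)$ means the output of the closed-loop system obtained by inserting $\boldsymbol u_{\mathrm E}(t)=K(\sigma)\boldsymbol y_{\mathrm E}(t)+K_0(\sigma)\boldsymbol u(t)$ into $\Sigma_{\mathrm E}$. *)

theory Defs
  imports "HOL-Analysis.Analysis" "Jordan_Normal_Form.Matrix" "Jordan_Normal_Form.DL_Rank"
begin

record state_space =
  sysA :: "real mat"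
  sysB :: "real mat"
  sysC :: "real mat"
  sysD :: "real mat"

definition is_state_space :: "nat \<Rightarrow> nat \<Rightarrow> nat \<Rightarrow> state_space \<Rightarrow> bool" where
  "is_state_space n m p G \<longleftrightarrow>
     sysA G \<in> carrier_mat n n \<and> sysB G \<in> carrier_mat n m \<and>
     sysC G \<in> carrier_mat p n \<and> sysD G \<in> carrier_mat p m"

definition absolutely_continuous_on_interval :: "real \<Rightarrow> real \<Rightarrow> (real \<Rightarrow> real) \<Rightarrow> bool" where
  "absolutely_continuous_on_interval a b f \<longleftrightarrow>
     (\<forall>e>0. \<exists>d>0. \<forall>(N::nat) l r.
        (\<forall>k<N. a \<le> l k \<and> l k \<le> r k \<and> r k \<le> b) \<longrightarrow>
        (\<forall>j<N. \<forall>k<N. j \<noteq> k \<longrightarrow> {l j<..<r j} \<inter> {l k<..<r k} = {}) \<longrightarrow>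
        (\<Sum>k<N. r k - l k) < d \<longrightarrow>
        (\<Sum>k<N. \<bar>f (r k) - f (l k)\<bar>) < e)"

definition has_vec_derivative :: "(real \<Rightarrow> real vec) \<Rightarrow> real vec \<Rightarrow> real \<Rightarrow> bool" where
  "has_vec_derivative x v t \<longleftrightarrow>
     (\<forall>i<dim_vec v. ((\<lambda>\<tau>. x \<tau> $ i) has_real_derivative v $ i) (at t))"

text \<open>
  State and output \<open>x\<close>, \<open>y\<close> on \<open>[0,\<infinity>)\<close>, from zero initial state, of the system whose
  matrices at time \<open>t\<close> are those of \<open>G t\<close>.  Since these matrices and the input may be
  discontinuous, solutions are understood in the sense of Caratheodory: the state is locally
  absolutely continuous and satisfies the differential equation at almost every time.  The output
  equation holds at every time.
\<close>
definition trajectory ::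
    "nat \<Rightarrow> (real \<Rightarrow> state_space) \<Rightarrow> (real \<Rightarrow> real vec) \<Rightarrow> (real \<Rightarrow> real vec) \<Rightarrow> (real \<Rightarrow> real vec) \<Rightarrow> bool" where
  "trajectory n G u x y \<longleftrightarrow>
     x 0 = 0\<^sub>v n \<and>
     (\<forall>t\<ge>0. x t \<in> carrier_vec n) \<and>
     (\<forall>b\<ge>0. \<forall>i<n. absolutely_continuous_on_interval 0 b (\<lambda>t. x t $ i)) \<and>
     (AE t in lborel. 0 < t \<longrightarrow>
        has_vec_derivative x (sysA (G t) *\<^sub>v x t + sysB (G t) *\<^sub>v u t) t) \<and>
     (\<forall>t\<ge>0. y t = sysC (G t) *\<^sub>v x t + sysD (G t) *\<^sub>v u t)"

text \<open>
  Switching times \<open>0 = \<tau> 0 < \<dots> < \<tau> s\<close>.  The value at a switching time itself is arbitrary, which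
  covers both one-sided continuity conventions.
\<close>
definition piecewise_constant :: "(real \<Rightarrow> nat) \<Rightarrow> bool" where
  "piecewise_constant f \<longleftrightarrow>
     (\<exists>(s::nat) \<tau>. \<tau> 0 = 0 \<and> (\<forall>k<s. \<tau> k < \<tau> (Suc k)) \<and>
        (\<forall>k<s. f constant_on {\<tau> k<..<\<tau> (Suc k)}) \<and> f constant_on {\<tau> s<..})"

definition switched_system :: "nat \<Rightarrow> nat \<Rightarrow> nat \<Rightarrow> nat \<Rightarrow> (nat \<Rightarrow> state_space) \<Rightarrow> bool" where
  "switched_system n m p l \<Sigma> \<longleftrightarrow> l \<ge> 1 \<and> (\<forall>i\<in>{1..l}. is_state_space n m p (\<Sigma> i))"

definition switching_law :: "nat \<Rightarrow> nat \<Rightarrow> (real \<Rightarrow> real vec \<Rightarrow> nat) \<Rightarrow> bool" where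
  "switching_law p l \<sigma> \<longleftrightarrow> (\<forall>t\<ge>0. \<forall>v\<in>carrier_vec p. \<sigma> t v \<in> {1..l})"

text \<open>
  Under an output-dependent law \<open>\<sigma>\<close> a trajectory need be neither unique nor exist for every input,
  so outputs form a relation; the active mode along a trajectory is \<open>\<sigma> t (y t)\<close>.
\<close>
definition switched_output ::
    "nat \<Rightarrow> (nat \<Rightarrow> state_space) \<Rightarrow> (real \<Rightarrow> real vec \<Rightarrow> nat) \<Rightarrow> (real \<Rightarrow> real vec) \<Rightarrow> (real \<Rightarrow> real vec) \<Rightarrow> bool" where
  "switched_output n \<Sigma> \<sigma> u y \<longleftrightarrow> (\<exists>x. trajectory n (\<lambda>t. \<Sigma> (\<sigma> t (y t))) u x y)"

definition DeltaA :: "(nat \<Rightarrow> state_space) \<Rightarrow> nat \<Rightarrow> real mat" where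
  "DeltaA \<Sigma> i = sysA (\<Sigma> 1) - sysA (\<Sigma> i)"
definition DeltaB :: "(nat \<Rightarrow> state_space) \<Rightarrow> nat \<Rightarrow> real mat" where
  "DeltaB \<Sigma> i = sysB (\<Sigma> 1) - sysB (\<Sigma> i)"
definition DeltaC :: "(nat \<Rightarrow> state_space) \<Rightarrow> nat \<Rightarrow> real mat" where
  "DeltaC \<Sigma> i = sysC (\<Sigma> 1) - sysC (\<Sigma> i)"
definition DeltaD :: "(nat \<Rightarrow> state_space) \<Rightarrow> nat \<Rightarrow> real mat" where
  "DeltaD \<Sigma> i = sysD (\<Sigma> 1) - sysD (\<Sigma> i)"

definition rk :: "nat \<Rightarrow> (nat \<Rightarrow> state_space) \<Rightarrow> nat \<Rightarrow> nat" where
  "rk n \<Sigma> i = vec_space.rank n (DeltaA \<Sigma> i)"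

definition rk_sum :: "nat \<Rightarrow> nat \<Rightarrow> (nat \<Rightarrow> state_space) \<Rightarrow> nat" where
  "rk_sum n l \<Sigma> = (\<Sum>i=2..l. rk n \<Sigma> i)"

definition decomposition ::
    "nat \<Rightarrow> nat \<Rightarrow> (nat \<Rightarrow> state_space) \<Rightarrow> (nat \<Rightarrow> real mat) \<Rightarrow> (nat \<Rightarrow> real mat) \<Rightarrow> (nat \<Rightarrow> real mat) \<Rightarrow> bool" where
  "decomposition n l \<Sigma> S M T \<longleftrightarrow>
     (\<forall>i\<in>{2..l}. S i \<in> carrier_mat n (rk n \<Sigma> i) \<and> M i \<in> carrier_mat (rk n \<Sigma> i) (rk n \<Sigma> i) \<and>
        T i \<in> carrier_mat n (rk n \<Sigma> i) \<and> DeltaA \<Sigma> i = S i * M i * transpose_mat (T i))"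

text \<open>Horizontal concatenation of matrices that all have \<open>r\<close> rows.\<close>
definition block_row :: "nat \<Rightarrow> real mat list \<Rightarrow> real mat" where
  "block_row r As =
     foldr (\<lambda>A B. four_block_mat A B (0\<^sub>m 0 (dim_col A)) (0\<^sub>m 0 (dim_col B))) As (0\<^sub>m r 0)"

definition envelope ::
    "nat \<Rightarrow> nat \<Rightarrow> (nat \<Rightarrow> state_space) \<Rightarrow> (nat \<Rightarrow> real mat) \<Rightarrow> (nat \<Rightarrow> real mat) \<Rightarrow> state_space" where
  "envelope n l \<Sigma> S T =
     \<lparr> sysA = sysA (\<Sigma> 1),
       sysB = block_row n ([sysB (\<Sigma> 1)] @ map (DeltaB \<Sigma>) [2..<Suc l] @ map S [2..<Suc l]),
       sysC = transpose_mat (block_row n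
         ([transpose_mat (sysC (\<Sigma> 1))] @ map (\<lambda>i. transpose_mat (DeltaC \<Sigma> i)) [2..<Suc l] @
          map T [2..<Suc l])),
       sysD = diag_block_mat
         ([sysD (\<Sigma> 1)] @ map (\<lambda>i. - DeltaD \<Sigma> i) [2..<Suc l] @
          [0\<^sub>m (rk_sum n l \<Sigma>) (rk_sum n l \<Sigma>)]) \<rparr>"

definition delta :: "nat \<Rightarrow> nat \<Rightarrow> real" where
  "delta i j = (if i = j then 1 else 0)"

definition fbK :: "nat \<Rightarrow> nat \<Rightarrow> nat \<Rightarrow> (nat \<Rightarrow> real mat) \<Rightarrow> nat \<Rightarrow> real mat" where
  "fbK m p l M j =
     diag_block_mat (0\<^sub>m (l * m) (l * p) # map (\<lambda>i. (- delta i j) \<cdot>\<^sub>m M i) [2..<Suc l])"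

definition fbK0 :: "nat \<Rightarrow> nat \<Rightarrow> nat \<Rightarrow> (nat \<Rightarrow> state_space) \<Rightarrow> nat \<Rightarrow> real mat" where
  "fbK0 n m l \<Sigma> j = transpose_mat (block_row m
     ([1\<^sub>m m] @ map (\<lambda>i. (- delta i j) \<cdot>\<^sub>m 1\<^sub>m m) [2..<Suc l] @ [0\<^sub>m m (rk_sum n l \<Sigma>)]))"

definition fbC0 :: "nat \<Rightarrow> nat \<Rightarrow> nat \<Rightarrow> (nat \<Rightarrow> state_space) \<Rightarrow> nat \<Rightarrow> real mat" where
  "fbC0 n p l \<Sigma> j = block_row p
     ([1\<^sub>m p] @ map (\<lambda>i. (- delta i j) \<cdot>\<^sub>m 1\<^sub>m p) [2..<Suc l] @ [0\<^sub>m p (rk_sum n l \<Sigma>)])"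

text \<open>
  \<open>yE\<close> is an output of the time-invariant system \<open>E\<close> in closed loop with
  \<open>uE t = K t *\<^sub>v yE t + K0 t *\<^sub>v u t\<close>.
\<close>
definition closed_loop_output ::
    "nat \<Rightarrow> state_space \<Rightarrow> (real \<Rightarrow> real mat) \<Rightarrow> (real \<Rightarrow> real mat) \<Rightarrow> (real \<Rightarrow> real vec) \<Rightarrow> (real \<Rightarrow> real vec) \<Rightarrow> bool" where
  "closed_loop_output n E K K0 u yE \<longleftrightarrow>
     (\<exists>uE xE. trajectory n (\<lambda>_. E) uE xE yE \<and>
        (\<forall>t\<ge>0. uE t = K t *\<^sub>v yE t + K0 t *\<^sub>v u t))"

end

theory Submission
  imports Defs
begin

text \<open>
  For a given active-mode function both the switched system and the closed loop are linear
  time-varying systems in the same state.  The feedback gain only reads those outputs of the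
  envelope on which the input has no direct influence, so the algebraic loop has exactly one
  solution \<open>u\<^sub>E\<close>, an explicit function of the state and of \<open>u\<close>; substituting it turns the
  envelope equations into those of the active mode.  It remains to see that Caratheodory solutions
  are unique: the difference \<open>z\<close> of two states is locally absolutely continuous with
  \<open>|z'| \<le> L |z|\<close> almost everywhere and \<open>z(0) = 0\<close>, hence it vanishes on successive intervals
  shorter than \<open>1 / (n L)\<close>.
\<close>

section \<open>Absolutely continuous functions\<close>

text \<open>Under an output-dependent law the switched system may have several trajectories, so
  \<open>u\<close> need not determine \<open>y\<close>. Uniqueness is recovered by freezing the mode
  function \<open>s\<close> of the given trajectory: the closed loop is driven by this
  \<open>s\<close>, and its output multiplied by \<open>fbC0\<close> is an output of the same linear
  time-varying system, with a state that still has to be identified with the one behind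
  \<open>y\<close>. The conclusion therefore has two halves: some closed-loop output exists, and
  every one of them reproduces \<open>y\<close>. The analytic obstacle is that the state equation
  holds only almost everywhere. Continuity would not suffice: a Cantor-type function has derivative
  zero almost everywhere without being constant. Hence a mean value inequality for absolutely
  continuous functions is derived straight from the epsilon-delta definition. It involves no
  integral of the derivative, so no measurability is asked of the right-hand side; the input, of
  which only the dimension is known, cancels in the difference of two states.\<close>

definition intervals_within :: "real \<Rightarrow> real \<Rightarrow> nat \<Rightarrow> (nat \<Rightarrow> real) \<Rightarrow> (nat \<Rightarrow> real) \<Rightarrow> bool" where
  "intervals_within a b N l r \<longleftrightarrow> (\<forall>k<N. a \<le> l k \<and> l k \<le> r k \<and> r k \<le> b) \<and>
     (\<forall>j<N. \<forall>k<N. j \<noteq> k \<longrightarrow> {l j<..<r j} \<inter> {l k<..<r k} = {})"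

lemma absolutely_continuous_on_interval_iff:
  "absolutely_continuous_on_interval a b f \<longleftrightarrow>
    (\<forall>e>0. \<exists>d>0. \<forall>N l r. intervals_within a b N l r \<longrightarrow> (\<Sum>k<N. r k - l k) < d \<longrightarrow>
       (\<Sum>k<N. \<bar>f (r k) - f (l k)\<bar>) < e)"
  unfolding absolutely_continuous_on_interval_def intervals_within_def imp_conjL ..

lemma absolutely_continuous_on_intervalE:
  assumes "absolutely_continuous_on_interval a b f" "e > 0"
  obtains d where "d > 0" "\<And>N l r. intervals_within a b N l r \<Longrightarrow> (\<Sum>k<N. r k - l k) < d \<Longrightarrow>
    (\<Sum>k<N. \<bar>f (r k) - f (l k)\<bar>) < e"
  using assms unfolding absolutely_continuous_on_interval_iff by blast

lemma absolutely_continuous_on_interval_subset: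
  assumes "absolutely_continuous_on_interval a b f" "a \<le> c" "d \<le> b"
  shows "absolutely_continuous_on_interval c d f"
proof -
  have within: "intervals_within a b N l r" if "intervals_within c d N l r" for N l r
    using that assms(2,3) unfolding intervals_within_def by force
  show ?thesis
    unfolding absolutely_continuous_on_interval_iff
  proof (intro allI impI)
    fix e :: real assume "e > 0"
    then obtain \<delta> where "\<delta> > 0" "\<And>N l r. intervals_within a b N l r \<Longrightarrow>
        (\<Sum>k<N. r k - l k) < \<delta> \<Longrightarrow> (\<Sum>k<N. \<bar>f (r k) - f (l k)\<bar>) < e"
      using absolutely_continuous_on_intervalE[OF assms(1)] by metis
    then show "\<exists>\<delta>>0. \<forall>N l r. intervals_within c d N l r \<longrightarrow> (\<Sum>k<N. r k - l k) < \<delta> \<longrightarrow>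
        (\<Sum>k<N. \<bar>f (r k) - f (l k)\<bar>) < e"
      using within by (intro exI[of _ \<delta>]) simp
  qed
qed

lemma absolutely_continuous_on_interval_diff:
  assumes "absolutely_continuous_on_interval a b f" "absolutely_continuous_on_interval a b g"
  shows "absolutely_continuous_on_interval a b (\<lambda>t. f t - g t)"
  unfolding absolutely_continuous_on_interval_iff
proof (intro allI impI)
  fix e :: real assume "e > 0"
  then have e2: "e / 2 > 0" by simp
  obtain d1 where d1: "d1 > 0" "\<And>N l r. intervals_within a b N l r \<Longrightarrow>
      (\<Sum>k<N. r k - l k) < d1 \<Longrightarrow> (\<Sum>k<N. \<bar>f (r k) - f (l k)\<bar>) < e / 2"
    using absolutely_continuous_on_intervalE[OF assms(1) e2] by blast
  obtain d2 where d2: "d2 > 0" "\<And>N l r. intervals_within a b N l r \<Longrightarrow>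
      (\<Sum>k<N. r k - l k) < d2 \<Longrightarrow> (\<Sum>k<N. \<bar>g (r k) - g (l k)\<bar>) < e / 2"
    using absolutely_continuous_on_intervalE[OF assms(2) e2] by blast
  have "(\<Sum>k<N. \<bar>f (r k) - g (r k) - (f (l k) - g (l k))\<bar>) < e"
    if *: "intervals_within a b N l r" "(\<Sum>k<N. r k - l k) < min d1 d2" for N l r
  proof -
    have "(\<Sum>k<N. \<bar>f (r k) - g (r k) - (f (l k) - g (l k))\<bar>)
        \<le> (\<Sum>k<N. \<bar>f (r k) - f (l k)\<bar> + \<bar>g (r k) - g (l k)\<bar>)"
      by (rule sum_mono) linarith
    also have "\<dots> = (\<Sum>k<N. \<bar>f (r k) - f (l k)\<bar>) + (\<Sum>k<N. \<bar>g (r k) - g (l k)\<bar>)"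
      by (rule sum.distrib)
    also have "\<dots> < e / 2 + e / 2"
      using d1(2)[OF *(1)] d2(2)[OF *(1)] *(2) by (intro add_strict_mono) auto
    finally show ?thesis by simp
  qed
  moreover have "min d1 d2 > 0" using d1(1) d2(1) by simp
  ultimately show "\<exists>d>0. \<forall>N l r. intervals_within a b N l r \<longrightarrow> (\<Sum>k<N. r k - l k) < d \<longrightarrow>
      (\<Sum>k<N. \<bar>f (r k) - g (r k) - (f (l k) - g (l k))\<bar>) < e"
    by blast
qed

lemma absolutely_continuous_on_interval_imp_continuous_on:
  assumes "absolutely_continuous_on_interval a b f"
  shows "continuous_on {a..b} f"
  unfolding continuous_on_iff
proof (intro ballI allI impI)
  fix t e :: real assume t: "t \<in> {a..b}" and e: "e > 0"
  obtain d where d: "d > 0" "\<And>N l r. intervals_within a b N l r \<Longrightarrow>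
      (\<Sum>k<N. r k - l k) < d \<Longrightarrow> (\<Sum>k<N. \<bar>f (r k) - f (l k)\<bar>) < e"
    using absolutely_continuous_on_intervalE[OF assms e] by blast
  have "dist (f s) (f t) < e" if s: "s \<in> {a..b}" "dist s t < d" for s
    \<comment> \<open>A family of one interval, with end points \<open>s\<close> and
      \<open>t\<close> in either order.\<close>
    using d(2)[of 1 "\<lambda>_. min s t" "\<lambda>_. max s t"] s t
    by (cases "s \<le> t") (auto simp: intervals_within_def dist_real_def abs_minus_commute)
  then show "\<exists>d>0. \<forall>s\<in>{a..b}. dist s t < d \<longrightarrow> dist (f s) (f t) < e"
    using d(1) by blast
qed

section \<open>Mean value inequality from a derivative bound almost everywhere\<close>

lemma null_set_open_cover:
  fixes e :: real
  assumes "N \<in> null_sets lborel" "e > 0"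
  obtains U where "open U" "N \<subseteq> U" "U \<in> fmeasurable lborel" "measure lborel U < e"
proof -
  have "N \<in> sets borel" using assms(1) by (simp add: null_sets_def)
  then obtain U where U: "open U" "N \<subseteq> U" "emeasure lborel (U - N) < ennreal e"
    using outer_regular_lborel \<open>e > 0\<close> by blast
  have "U \<in> sets lborel" using U(1) by simp
  \<comment> \<open>Outer regularity only controls \<open>U - N\<close>; as \<open>N\<close> is
    null, this is the full measure of \<open>U\<close>.\<close>
  then have "emeasure lborel (U - N) = emeasure lborel U"
    using emeasure_Diff_null_set[OF assms(1)] by simp
  then have lt: "emeasure lborel U < ennreal e" using U(3) by simp
  then have fm: "U \<in> fmeasurable lborel"
    using \<open>U \<in> sets lborel\<close> by (intro fmeasurableI) (auto simp: top.not_eq_extremum intro: less_trans)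
  moreover have "measure lborel U < e"
    using lt emeasure_eq_measure2[OF fm] assms(2) by (simp add: ennreal_less_iff)
  ultimately show thesis using that U by blast
qed

text \<open>The intervals of a partial division have disjoint interiors, so their total length is
  the measure of a union contained in \<open>U\<close>. This brings absolute continuity into the
  form in which a fine division can use it.\<close>

lemma absolutely_continuous_tagged_partial_division:
  assumes ac: "absolutely_continuous_on_interval a b f" and "e > 0"
  obtains d where "d > 0"
    "\<And>q U. \<lbrakk>q tagged_partial_division_of {a..b}; \<And>x K. (x, K) \<in> q \<Longrightarrow> K \<subseteq> U;
       U \<in> fmeasurable lborel; measure lborel U < d\<rbrakk>
      \<Longrightarrow> (\<Sum>(x, K)\<in>q. \<bar>f (Sup K) - f (Inf K)\<bar>) < e"
proof -
  obtain d where d: "d > 0" "\<And>N l r. intervals_within a b N l r \<Longrightarrow>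
      (\<Sum>k<N. r k - l k) < d \<Longrightarrow> (\<Sum>k<N. \<bar>f (r k) - f (l k)\<bar>) < e"
    using absolutely_continuous_on_intervalE[OF assms] by blast
  have "(\<Sum>(x, K)\<in>q. \<bar>f (Sup K) - f (Inf K)\<bar>) < e"
    if q: "q tagged_partial_division_of {a..b}" and sub: "\<And>x K. (x, K) \<in> q \<Longrightarrow> K \<subseteq> U"
      and U: "U \<in> fmeasurable lborel" "measure lborel U < d" for q U
  proof -
    note qD = tagged_partial_division_ofD[OF q]
    \<comment> \<open>An enumeration turns the finite set of tagged intervals into an indexed
      family.\<close>
    obtain h where h: "bij_betw h {..<card q} q"
      using ex_bij_betw_nat_finite[OF qD(1)] by (auto simp: atLeast0LessThan)
    define l r where "l = (\<lambda>k. Inf (snd (h k)))" and "r = (\<lambda>k. Sup (snd (h k)))"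
    have K: "snd (h k) = {l k..r k} \<and> l k \<le> r k \<and> h k \<in> q" if "k < card q" for k
    proof -
      have hk: "h k \<in> q" using h that by (auto simp: bij_betw_def)
      then have "(fst (h k), snd (h k)) \<in> q" by simp
      then obtain c d where cd: "snd (h k) = cbox c d" "fst (h k) \<in> snd (h k)"
        using qD(2,4) by blast
      then have "c \<le> d" by auto
      then show ?thesis using cd hk unfolding l_def r_def by auto
    qed
    have bds: "\<forall>k<card q. a \<le> l k \<and> l k \<le> r k \<and> r k \<le> b"
    proof (intro allI impI)
      fix k assume "k < card q"
      from K[OF this] qD(3)[of "fst (h k)" "snd (h k)"]
      show "a \<le> l k \<and> l k \<le> r k \<and> r k \<le> b" by (cases "h k") auto
    qed
    have disj: "{l j<..<r j} \<inter> {l k<..<r k} = {}" if "j < card q" "k < card q" "j \<noteq> k" for j k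
    proof -
      have "h j \<noteq> h k" using h that by (auto simp: bij_betw_def inj_on_def)
      then have "interior (snd (h j)) \<inter> interior (snd (h k)) = {}"
        using qD(5)[of "fst (h j)" "snd (h j)" "fst (h k)" "snd (h k)"] K[OF that(1)] K[OF that(2)]
        by (metis prod.collapse)
      then show ?thesis using K[OF that(1)] K[OF that(2)] by simp
    qed
    \<comment> \<open>Closed intervals of a division may share end points; the open ones are
      disjoint and have the same lengths.\<close>
    have "(\<Sum>k<card q. r k - l k) = (\<Sum>k<card q. measure lborel {l k<..<r k})"
      using K by (intro sum.cong) auto
    also have "\<dots> = measure lborel (\<Union>k<card q. {l k<..<r k})"
    proof (rule measure_finite_Union[symmetric])
      show "disjoint_family_on (\<lambda>k. {l k<..<r k}) {..<card q}"
        unfolding disjoint_family_on_def using disj by blast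
      show "emeasure lborel {l k<..<r k} \<noteq> \<infinity>" if "k \<in> {..<card q}" for k
        using K[of k] that by simp
    qed auto
    also have "\<dots> \<le> measure lborel U"
    proof (rule measure_mono_fmeasurable[OF _ _ U(1)])
      show "(\<Union>k<card q. {l k<..<r k}) \<subseteq> U"
      proof (rule UN_least)
        fix k assume k: "k \<in> {..<card q}"
        have "{l k<..<r k} \<subseteq> snd (h k)" using K[of k] k
          by (simp add: greaterThanLessThan_subseteq_atLeastAtMost_iff)
        also have "\<dots> \<subseteq> U" using sub[of "fst (h k)" "snd (h k)"] K[of k] k by simp
        finally show "{l k<..<r k} \<subseteq> U" .
      qed
    qed auto
    finally have "(\<Sum>k<card q. r k - l k) < d" using U(2) by simp
    then have "(\<Sum>k<card q. \<bar>f (r k) - f (l k)\<bar>) < e"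
      using d(2) bds disj unfolding intervals_within_def by blast
    moreover have "(\<Sum>(x, K)\<in>q. \<bar>f (Sup K) - f (Inf K)\<bar>) = (\<Sum>k<card q. \<bar>f (r k) - f (l k)\<bar>)"
      using sum.reindex_bij_betw[OF h, of "\<lambda>(x, K). \<bar>f (Sup K) - f (Inf K)\<bar>"]
      by (simp add: case_prod_beta l_def r_def)
    ultimately show ?thesis by simp
  qed
  then show thesis using that d(1) by blast
qed

text \<open>
  Cousin's lemma: tags outside the exceptional null set are estimated by their derivative, the
  remaining intervals lie in an open set of small measure and are estimated by absolute continuity.
\<close>
lemma absolutely_continuous_AE_derivative_bound:
  assumes ac: "absolutely_continuous_on_interval a b f" and "a \<le> b" and "0 \<le> K"
    and der: "AE t in lborel. a < t \<and> t < b \<longrightarrow> (\<exists>D. (f has_real_derivative D) (at t) \<and> \<bar>D\<bar> \<le> K)"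
  shows "\<bar>f b - f a\<bar> \<le> K * (b - a)"
proof (rule field_le_epsilon)
  fix e0 :: real assume "e0 > 0"
  \<comment> \<open>The error is spent twice: \<open>e\<close> per unit length at tags with a
    derivative, and \<open>e\<close> in total on the exceptional intervals. The summand 1 keeps the
    divisor positive when \<open>a = b\<close>.\<close>
  define e where "e = e0 / (1 + (b - a))"
  have e: "e > 0" "e * (b - a) + e = e0"
  proof -
    have "e * (1 + (b - a)) = e0" "1 + (b - a) > 0" using \<open>a \<le> b\<close> by (auto simp: e_def)
    then show "e > 0" "e * (b - a) + e = e0"
      using \<open>e0 > 0\<close> by (auto simp: distrib_left e_def)
  qed
  obtain N0 where N0: "N0 \<in> null_sets lborel"
    "\<And>t. t \<notin> N0 \<Longrightarrow> a < t \<Longrightarrow> t < b \<Longrightarrow> \<exists>D. (f has_real_derivative D) (at t) \<and> \<bar>D\<bar> \<le> K"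
    using der by (auto elim!: AE_E3)
  \<comment> \<open>The end points join the exceptional set because the derivative is only known
    strictly between them.\<close>
  define N where "N = N0 \<union> {a, b}"
  have N: "N \<in> null_sets lborel"
    unfolding N_def using N0(1) by (intro null_sets.Un) (auto intro: finite_imp_null_set_lborel)
  obtain d where d: "d > 0"
    "\<And>q U. \<lbrakk>q tagged_partial_division_of {a..b}; \<And>x K. (x, K) \<in> q \<Longrightarrow> K \<subseteq> U;
       U \<in> fmeasurable lborel; measure lborel U < d\<rbrakk>
      \<Longrightarrow> (\<Sum>(x, K)\<in>q. \<bar>f (Sup K) - f (Inf K)\<bar>) < e"
    using absolutely_continuous_tagged_partial_division[OF ac e(1)] by blast
  obtain U where U: "open U" "N \<subseteq> U" "U \<in> fmeasurable lborel" "measure lborel U < d"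
    using null_set_open_cover[OF N d(1)] by blast
  \<comment> \<open>The value of the gauge at \<open>t\<close>: an exceptional tag confines its
    interval to \<open>U\<close>, any other tag in the interval allows only points where the
    increment from the tag has slope at most \<open>K + e\<close>. A gauge is defined on all reals,
    so points outside \<open>{a..b}\<close> need some open set too.\<close>
  have "\<exists>G. open G \<and> t \<in> G \<and> (t \<in> N \<longrightarrow> G \<subseteq> U) \<and>
      (t \<notin> N \<longrightarrow> t \<in> {a..b} \<longrightarrow> (\<forall>s\<in>G. \<bar>f s - f t\<bar> \<le> (K + e) * \<bar>s - t\<bar>))" for t
  proof (cases "t \<in> N \<or> t \<notin> {a..b}")
    case True
    then show ?thesis using U by (cases "t \<in> N") auto
  next
    case False
    then have "a < t" "t < b" "t \<notin> N0" by (auto simp: N_def)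
    then obtain D where D: "(f has_real_derivative D) (at t)" "\<bar>D\<bar> \<le> K" using N0(2) by blast
    from D(1) have "(f has_derivative (\<lambda>h. h * D)) (at t)"
      by (simp add: has_field_derivative_def mult_commute_abs)
    then obtain \<delta> where \<delta>: "\<delta> > 0"
      "\<And>s. norm (s - t) < \<delta> \<Longrightarrow> norm (f s - f t - (s - t) * D) \<le> e * norm (s - t)"
      using e(1) unfolding has_derivative_at_alt by blast
    have "\<bar>f s - f t\<bar> \<le> (K + e) * \<bar>s - t\<bar>" if "s \<in> ball t \<delta>" for s
    proof -
      have "\<bar>f s - f t - (s - t) * D\<bar> \<le> e * \<bar>s - t\<bar>"
        using \<delta>(2)[of s] that by (simp add: dist_real_def abs_minus_commute)
      moreover have "\<bar>(s - t) * D\<bar> \<le> K * \<bar>s - t\<bar>"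
        using D(2) by (simp add: abs_mult mult.commute mult_right_mono)
      ultimately show ?thesis by (simp add: distrib_right)
    qed
    then show ?thesis using False \<delta>(1) by (intro exI[of _ "ball t \<delta>"]) auto
  qed
  then obtain G where G: "\<And>t. open (G t)" "\<And>t. t \<in> G t" "\<And>t. t \<in> N \<Longrightarrow> G t \<subseteq> U"
    "\<And>t s. t \<notin> N \<Longrightarrow> t \<in> {a..b} \<Longrightarrow> s \<in> G t \<Longrightarrow> \<bar>f s - f t\<bar> \<le> (K + e) * \<bar>s - t\<bar>"
    by metis
  have "gauge G" using G(1,2) by (simp add: gauge_def)
  then obtain p where p: "p tagged_division_of {a..b}" "G fine p"
    using fine_division_exists_real by blast
  note pD = tagged_division_ofD[OF p(1)]
  define q where "q = {(x, I) \<in> p. x \<in> N}"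
  have q: "q \<subseteq> p" "finite q" using pD(1) by (auto simp: q_def intro: finite_subset)
  have len: "(\<Sum>(x, I)\<in>p. Sup I - Inf I) = b - a"
    using additive_tagged_division_1[OF \<open>a \<le> b\<close> p(1), of "\<lambda>x. x"] by simp
  have le: "Inf I \<le> Sup I" if xI: "(x, I) \<in> p" for x I
  proof -
    obtain c d where "I = cbox c d" "x \<in> I" using pD(2)[OF xI] pD(4)[OF xI] by blast
    then have "c \<le> d" by auto
    then show ?thesis using \<open>I = cbox c d\<close> by simp
  qed
  \<comment> \<open>The gauge compares values only with the value at the tag, so the interval is cut
    at its tag and the two increments are added.\<close>
  have good: "\<bar>f (Sup I) - f (Inf I)\<bar> \<le> (K + e) * (Sup I - Inf I)"
    if "(x, I) \<in> p - q" for x I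
  proof -
    from that have xI: "(x, I) \<in> p" "x \<notin> N" by (auto simp: q_def)
    obtain c d where cd: "I = cbox c d" "x \<in> I"
      using pD(2)[OF xI(1)] pD(4)[OF xI(1)] by blast
    then have *: "c \<le> x" "x \<le> d" "Inf I = c" "Sup I = d" by auto
    have "I \<subseteq> G x" using p(2) xI(1) by (auto simp: fine_def)
    moreover have "x \<in> {a..b}" using pD(3)[OF xI(1)] cd(2) by auto
    moreover have "c \<in> I" "d \<in> I" using cd * by auto
    ultimately have "\<bar>f d - f x\<bar> \<le> (K + e) * \<bar>d - x\<bar>" "\<bar>f c - f x\<bar> \<le> (K + e) * \<bar>c - x\<bar>"
      using G(4)[OF xI(2), of c] G(4)[OF xI(2), of d] by blast+
    then have "\<bar>f d - f c\<bar> \<le> (K + e) * (d - x) + (K + e) * (x - c)" using *(1,2) by auto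
    also have "\<dots> = (K + e) * (d - c)" by (simp add: algebra_simps)
    finally show ?thesis using * by simp
  qed
  have bad: "(\<Sum>(x, I)\<in>q. \<bar>f (Sup I) - f (Inf I)\<bar>) < e"
  proof (rule d(2)[OF _ _ U(3,4)])
    show "q tagged_partial_division_of {a..b}"
      using p(1) by (intro tagged_partial_division_subset[OF _ q(1)]) (simp add: tagged_division_of_def)
    show "I \<subseteq> U" if "(x, I) \<in> q" for x I
      using that p(2) G(3) by (fastforce simp: q_def fine_def)
  qed
  have "\<bar>f b - f a\<bar> = \<bar>\<Sum>(x, I)\<in>p. f (Sup I) - f (Inf I)\<bar>"
    using additive_tagged_division_1[OF \<open>a \<le> b\<close> p(1), of f] by simp
  also have "\<dots> \<le> (\<Sum>(x, I)\<in>p. \<bar>f (Sup I) - f (Inf I)\<bar>)"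
    by (rule order_trans[OF sum_abs]) (simp add: case_prod_beta)
  also have "\<dots> = (\<Sum>(x, I)\<in>p - q. \<bar>f (Sup I) - f (Inf I)\<bar>) + (\<Sum>(x, I)\<in>q. \<bar>f (Sup I) - f (Inf I)\<bar>)"
    by (rule sum.subset_diff[OF q(1) pD(1)])
  also have "(\<Sum>(x, I)\<in>p - q. \<bar>f (Sup I) - f (Inf I)\<bar>) \<le> (\<Sum>(x, I)\<in>p - q. (K + e) * (Sup I - Inf I))"
    using good by (intro sum_mono) auto
  also have "\<dots> \<le> (\<Sum>(x, I)\<in>p. (K + e) * (Sup I - Inf I))"
    using pD(1) le \<open>0 \<le> K\<close> e(1) by (intro sum_mono2) (auto intro!: mult_nonneg_nonneg)
  also have "\<dots> = (K + e) * (b - a)"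
    by (simp add: len[symmetric] sum_distrib_left case_prod_beta)
  finally have "\<bar>f b - f a\<bar> \<le> (K + e) * (b - a) + e" using bad by linarith
  then show "\<bar>f b - f a\<bar> \<le> K * (b - a) + e0" using e(2) by (simp add: algebra_simps)
qed

text \<open>A Gronwall-type statement proved by contraction: on a short interval that starts at a
  common zero, the maximum of the sum of all \<open>\<bar>z j t\<bar>\<close> is bounded by half of
  itself. Only continuity is used to obtain this maximum, and the mean value inequality replaces
  integration of the bound.\<close>

lemma zero_if_derivative_linearly_bounded:
  fixes z :: "nat \<Rightarrow> real \<Rightarrow> real"
  assumes ac: "\<And>b i. b \<ge> 0 \<Longrightarrow> i < n \<Longrightarrow> absolutely_continuous_on_interval 0 b (z i)"
    and z0: "\<And>i. i < n \<Longrightarrow> z i 0 = 0" and "L \<ge> 0"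
    and der: "AE t in lborel. 0 < t \<longrightarrow> (\<forall>i<n. \<exists>D. (z i has_real_derivative D) (at t) \<and>
       \<bar>D\<bar> \<le> L * (\<Sum>j<n. \<bar>z j t\<bar>))"
    and "t \<ge> 0" "i < n"
  shows "z i t = 0"
proof -
  \<comment> \<open>The factor 2 makes the contraction constant \<open>n * L * h\<close> at most
    1/2; the summand 1 covers \<open>n * L = 0\<close>.\<close>
  define h where "h = 1 / (2 * (n * L + 1))"
  have pos: "n * L + 1 > 0" using \<open>L \<ge> 0\<close> by (simp add: add_nonneg_pos)
  then have h: "h > 0" by (simp add: h_def)
  have nLh: "n * L * h \<le> 1 / 2" using pos by (simp add: h_def field_simps)
  have steps: "\<forall>t. 0 \<le> t \<longrightarrow> t \<le> k * h \<longrightarrow> (\<forall>i<n. z i t = 0)" for k :: nat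
  proof (induction k)
    case 0
    then show ?case using z0 by simp
  next
    case (Suc k)
    define a where "a = k * h"
    have a: "a \<ge> 0" "Suc k * h = a + h" using h by (simp_all add: a_def algebra_simps)
    have za: "z i a = 0" if "i < n" for i using Suc.IH a(1) that by (simp add: a_def)
    define w where "w = (\<lambda>t. \<Sum>j<n. \<bar>z j t\<bar>)"
    have "continuous_on {0..a + h} (z j)" if "j < n" for j
      using ac[of "a + h" j] that a h by (intro absolutely_continuous_on_interval_imp_continuous_on) simp
    then have "continuous_on {0..a + h} w" unfolding w_def by (intro continuous_intros) auto
    then have "continuous_on {a..a + h} w" by (rule continuous_on_subset) (use a in auto)
    then obtain t0 where t0: "t0 \<in> {a..a + h}" "\<And>t. t \<in> {a..a + h} \<Longrightarrow> w t \<le> w t0"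
      using continuous_attains_sup[of "{a..a + h}" w] h by auto
    have w0: "w t \<ge> 0" for t by (simp add: w_def sum_nonneg)
    have bd: "\<bar>z i t\<bar> \<le> L * w t0 * h" if "t \<in> {a..a + h}" "i < n" for i t
    proof -
      have "\<bar>z i t - z i a\<bar> \<le> (L * w t0) * (t - a)"
      proof (rule absolutely_continuous_AE_derivative_bound)
        have i: "i < n" and t: "t \<in> {a..a + h}" by fact+
        show "absolutely_continuous_on_interval a t (z i)"
          using ac[of t i] that a by (auto intro: absolutely_continuous_on_interval_subset)
        show "a \<le> t" "0 \<le> L * w t0" using that \<open>L \<ge> 0\<close> w0 by auto
        show "AE s in lborel. a < s \<and> s < t \<longrightarrow>
            (\<exists>D. (z i has_real_derivative D) (at s) \<and> \<bar>D\<bar> \<le> L * w t0)"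
        proof (rule eventually_mono[OF der], intro impI)
          fix s assume s: "a < s \<and> s < t"
            and "0 < s \<longrightarrow> (\<forall>i<n. \<exists>D. (z i has_real_derivative D) (at s) \<and> \<bar>D\<bar> \<le> L * (\<Sum>j<n. \<bar>z j s\<bar>))"
          then obtain D where D: "(z i has_real_derivative D) (at s)" "\<bar>D\<bar> \<le> L * w s"
            using a(1) i unfolding w_def by (meson le_less_trans)
          moreover have "L * w s \<le> L * w t0"
            using t0(2)[of s] s t \<open>L \<ge> 0\<close> by (intro mult_left_mono) auto
          ultimately show "\<exists>D. (z i has_real_derivative D) (at s) \<and> \<bar>D\<bar> \<le> L * w t0"
            using order_trans by blast
        qed
      qed
      also have "\<dots> \<le> L * w t0 * h"
        using that \<open>L \<ge> 0\<close> w0 by (intro mult_left_mono) auto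
      finally show ?thesis using za that by simp
    qed
    \<comment> \<open>Adding the \<open>n\<close> component bounds at the maximum point itself
      bounds \<open>w t0\<close> by half of \<open>w t0\<close>; this is where the factor
      \<open>n\<close> in \<open>h\<close> comes from.\<close>
    have "w t0 \<le> (\<Sum>j<n. L * w t0 * h)"
      unfolding w_def using bd[OF t0(1)] by (intro sum_mono) (auto simp: w_def)
    also have "\<dots> = (n * L * h) * w t0" by simp
    also have "\<dots> \<le> 1 / 2 * w t0" using nLh w0 by (rule mult_right_mono)
    finally have "w t0 = 0" using w0[of t0] by simp
    then have "z i t = 0" if "t \<in> {a..a + h}" "i < n" for i t using bd[OF that] by simp
    then show ?case using Suc.IH a unfolding a_def[symmetric]
      by (metis atLeastAtMost_iff le_cases)
  qed
  obtain k :: nat where "t / h \<le> k" using real_arch_simple by blast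
  then have "t \<le> k * h" using h by (simp add: field_simps)
  then show ?thesis using steps[of k] assms(5,6) by blast
qed

section \<open>Uniqueness of trajectories\<close>

text \<open>Moves a state from one system to another. The right-hand sides need to agree only along
  this state, not as matrices, which is what lets the envelope under feedback and the switched
  system share their states.\<close>

lemma trajectory_cong:
  assumes "trajectory n G u x y"
    and "\<And>t. t \<ge> 0 \<Longrightarrow> sysA (G t) *\<^sub>v x t + sysB (G t) *\<^sub>v u t = sysA (G' t) *\<^sub>v x t + sysB (G' t) *\<^sub>v u' t"
    and "\<And>t. t \<ge> 0 \<Longrightarrow> y' t = sysC (G' t) *\<^sub>v x t + sysD (G' t) *\<^sub>v u' t"
  shows "trajectory n G' u' x y'"
proof -
  have "AE t in lborel. 0 < t \<longrightarrow>
      has_vec_derivative x (sysA (G t) *\<^sub>v x t + sysB (G t) *\<^sub>v u t) t"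
    using assms(1) by (simp add: trajectory_def)
  then have "AE t in lborel. 0 < t \<longrightarrow>
      has_vec_derivative x (sysA (G' t) *\<^sub>v x t + sysB (G' t) *\<^sub>v u' t) t"
    by (rule eventually_mono) (use assms(2) in auto)
  then show ?thesis using assms(1,3) by (simp add: trajectory_def)
qed

lemma abs_mult_mat_vec_le:
  assumes "A \<in> carrier_mat n n" "v \<in> carrier_vec n" "i < n"
    and "\<And>k. k < n \<Longrightarrow> \<bar>A $$ (i, k)\<bar> \<le> L"
  shows "\<bar>(A *\<^sub>v v) $ i\<bar> \<le> L * (\<Sum>k<n. \<bar>v $ k\<bar> :: real)"
proof -
  have "(A *\<^sub>v v) $ i = (\<Sum>k<n. A $$ (i, k) * v $ k)"
    using assms(1-3) by (simp add: scalar_prod_def atLeast0LessThan)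
  also have "\<bar>\<dots>\<bar> \<le> (\<Sum>k<n. \<bar>A $$ (i, k) * v $ k\<bar>)" by (rule sum_abs)
  also have "\<dots> \<le> (\<Sum>k<n. L * \<bar>v $ k\<bar>)"
    by (rule sum_mono) (use assms(4) in \<open>simp add: abs_mult mult_right_mono\<close>)
  finally show ?thesis by (simp add: sum_distrib_left)
qed

text \<open>The input terms cancel in the difference, which leaves the homogeneous equation; the
  entry bound \<open>L\<close>, uniform in time, then gives the linear derivative bound in every
  component.\<close>

lemma trajectory_state_unique:
  assumes x: "trajectory n G u x y" and x': "trajectory n G u x' y'"
    and G: "\<And>t. t \<ge> 0 \<Longrightarrow> is_state_space n m p (G t)"
    and u: "\<And>t. t \<ge> 0 \<Longrightarrow> u t \<in> carrier_vec m"
    and L: "L \<ge> 0" "\<And>t i k. t \<ge> 0 \<Longrightarrow> i < n \<Longrightarrow> k < n \<Longrightarrow> \<bar>sysA (G t) $$ (i, k)\<bar> \<le> L"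
    and "t \<ge> 0"
  shows "x t = x' t"
proof -
  have car: "x t \<in> carrier_vec n" "x' t \<in> carrier_vec n" if "t \<ge> 0" for t
    using x x' that by (simp_all add: trajectory_def)
  have "x t $ i - x' t $ i = 0" if "i < n" for i
  proof (rule zero_if_derivative_linearly_bounded[where z = "\<lambda>i t. x t $ i - x' t $ i", OF _ _ L(1) _ \<open>t \<ge> 0\<close> that])
    show "absolutely_continuous_on_interval 0 b (\<lambda>t. x t $ i - x' t $ i)" if "b \<ge> 0" "i < n" for b i
      using x x' that by (intro absolutely_continuous_on_interval_diff) (auto simp: trajectory_def)
    show "x 0 $ i - x' 0 $ i = 0" if "i < n" for i
      using x x' by (simp add: trajectory_def)
    have "AE t in lborel. 0 < t \<longrightarrow> has_vec_derivative x (sysA (G t) *\<^sub>v x t + sysB (G t) *\<^sub>v u t) t"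
      "AE t in lborel. 0 < t \<longrightarrow> has_vec_derivative x' (sysA (G t) *\<^sub>v x' t + sysB (G t) *\<^sub>v u t) t"
      using x x' by (simp_all add: trajectory_def)
    then show "AE t in lborel. 0 < t \<longrightarrow> (\<forall>i<n. \<exists>D. ((\<lambda>t. x t $ i - x' t $ i) has_real_derivative D) (at t) \<and>
        \<bar>D\<bar> \<le> L * (\<Sum>j<n. \<bar>x t $ j - x' t $ j\<bar>))"
    proof (rule eventually_elim2, intro impI allI)
      fix t i assume t: "0 < t" and i: "i < n"
        and "0 < t \<longrightarrow> has_vec_derivative x (sysA (G t) *\<^sub>v x t + sysB (G t) *\<^sub>v u t) t"
        and "0 < t \<longrightarrow> has_vec_derivative x' (sysA (G t) *\<^sub>v x' t + sysB (G t) *\<^sub>v u t) t"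
      then have der: "has_vec_derivative x (sysA (G t) *\<^sub>v x t + sysB (G t) *\<^sub>v u t) t"
        "has_vec_derivative x' (sysA (G t) *\<^sub>v x' t + sysB (G t) *\<^sub>v u t) t"
        by simp_all
      have A: "sysA (G t) \<in> carrier_mat n n" and B: "sysB (G t) \<in> carrier_mat n m"
        using G[of t] t by (simp_all add: is_state_space_def)
      have v: "x t \<in> carrier_vec n" "x' t \<in> carrier_vec n" using car t by simp_all
      let ?a = "(sysA (G t) *\<^sub>v x t) $ i" and ?a' = "(sysA (G t) *\<^sub>v x' t) $ i"
        and ?b = "(sysB (G t) *\<^sub>v u t) $ i"
      have "((\<lambda>t. x t $ i) has_real_derivative ?a + ?b) (at t)"
        "((\<lambda>t. x' t $ i) has_real_derivative ?a' + ?b) (at t)"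
        using der i A B by (simp_all add: has_vec_derivative_def)
      then have "((\<lambda>t. x t $ i - x' t $ i) has_real_derivative (?a + ?b) - (?a' + ?b)) (at t)"
        by (rule DERIV_diff)
      also have "(?a + ?b) - (?a' + ?b) = (sysA (G t) *\<^sub>v (x t - x' t)) $ i"
        unfolding mult_minus_distrib_mat_vec[OF A v] using A i by simp
      finally have "((\<lambda>t. x t $ i - x' t $ i) has_real_derivative
          (sysA (G t) *\<^sub>v (x t - x' t)) $ i) (at t)" .
      moreover have "\<bar>(sysA (G t) *\<^sub>v (x t - x' t)) $ i\<bar> \<le> L * (\<Sum>j<n. \<bar>(x t - x' t) $ j\<bar>)"
        by (rule abs_mult_mat_vec_le[OF A _ i]) (use v L(2) t i in auto)
      moreover have "(\<Sum>j<n. \<bar>(x t - x' t) $ j\<bar>) = (\<Sum>j<n. \<bar>x t $ j - x' t $ j\<bar>)"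
        by (rule sum.cong) (use v in auto)
      ultimately show "\<exists>D. ((\<lambda>t. x t $ i - x' t $ i) has_real_derivative D) (at t) \<and>
          \<bar>D\<bar> \<le> L * (\<Sum>j<n. \<bar>x t $ j - x' t $ j\<bar>)"
        by auto
    qed
  qed
  then show ?thesis using car[OF \<open>t \<ge> 0\<close>] by (intro eq_vecI) auto
qed

section \<open>Block matrices acting on concatenated vectors\<close>

text \<open>Nested to the right like \<open>block_row\<close> and \<open>diag_block_mat\<close>, so
  that one induction over the list of blocks treats matrix and vector together.\<close>

definition concat_vec :: "real vec list \<Rightarrow> real vec" where
  "concat_vec vs = foldr (@\<^sub>v) vs vNil"

lemma concat_vec_simps [simp]:
  "concat_vec [] = vNil"
  "concat_vec (v # vs) = v @\<^sub>v concat_vec vs"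
  by (simp_all add: concat_vec_def)

lemma dim_concat_vec [simp]: "dim_vec (concat_vec vs) = sum_list (map dim_vec vs)"
  by (induction vs) auto

lemma append_vec_assoc: "(u @\<^sub>v v) @\<^sub>v w = u @\<^sub>v v @\<^sub>v (w :: 'a vec)"
  by (rule eq_vecI) auto

lemma concat_vec_append: "concat_vec (vs @ ws) = concat_vec vs @\<^sub>v concat_vec ws"
  by (induction vs) (auto simp: append_vec_assoc)

lemma append_vec_add_dim:
  assumes "dim_vec v = dim_vec v'" "dim_vec w = dim_vec w'"
  shows "(v @\<^sub>v w) + (v' @\<^sub>v w') = (v + v') @\<^sub>v (w + (w' :: 'a :: plus vec))"
  by (rule eq_vecI) (use assms in auto)

lemma block_row_simps:
  "block_row r [] = 0\<^sub>m r 0"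
  "block_row r (A # As) =
    four_block_mat A (block_row r As) (0\<^sub>m 0 (dim_col A)) (0\<^sub>m 0 (dim_col (block_row r As)))"
  by (simp_all add: block_row_def)

lemma block_row_carrier:
  "\<forall>A\<in>set As. dim_row A = r \<Longrightarrow> block_row r As \<in> carrier_mat r (sum_list (map dim_col As))"
proof (induction As)
  case (Cons A As)
  then have "block_row r As \<in> carrier_mat r (sum_list (map dim_col As))" and A: "dim_row A = r"
    by simp_all
  then show ?case
    by (intro carrier_matI) (simp_all add: block_row_simps carrier_matD)
qed (simp add: block_row_simps)

text \<open>Stated for one component: the result is then a sum of reals, in which the Kronecker
  deltas can be evaluated.\<close>

lemma block_row_mult_concat_vec:
  assumes "list_all2 (\<lambda>A v. dim_row A = r \<and> dim_col A = dim_vec v) As vs" "k < r"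
  shows "(block_row r As *\<^sub>v concat_vec vs) $ k = (\<Sum>(A, v)\<leftarrow>zip As vs. (A *\<^sub>v v) $ k)"
  using assms(1)
proof (induction rule: list_all2_induct)
  case Nil
  then show ?case using assms(2) by (simp add: scalar_prod_def block_row_simps)
next
  case (Cons A As v vs)
  have rows: "\<forall>A\<in>set As. dim_row A = r" and cols: "map dim_col As = map dim_vec vs"
    using Cons.hyps(2)
    by (induction rule: list_all2_induct) auto
  have c: "block_row r As \<in> carrier_mat r (dim_vec (concat_vec vs))"
    using block_row_carrier[OF rows] cols by simp
  have "block_row r (A # As) *\<^sub>v concat_vec (v # vs) =
      (A *\<^sub>v v + block_row r As *\<^sub>v concat_vec vs) @\<^sub>v
      (0\<^sub>m 0 (dim_col A) *\<^sub>v v + 0\<^sub>m 0 (dim_col (block_row r As)) *\<^sub>v concat_vec vs)"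
    unfolding block_row_simps concat_vec_simps
    by (rule four_block_mat_mult_vec[of _ r "dim_vec v" _ "dim_vec (concat_vec vs)" _ 0])
      (use Cons.hyps(1) carrier_matD[OF c] in \<open>auto intro!: carrier_matI carrier_vecI\<close>)
  then show ?case using Cons c assms(2) by auto
qed

lemma col_four_block_row:
  assumes "i < dim_col A + dim_col B" "dim_row A = r" "dim_row B = r"
  shows "col (four_block_mat A B (0\<^sub>m 0 (dim_col A)) (0\<^sub>m 0 (dim_col B))) i =
    (if i < dim_col A then col A i else col B (i - dim_col A))"
  by (rule eq_vecI) (use assms in \<open>simp_all split: if_splits\<close>)

text \<open>A transposed block row is a block column and stacks the products. This is the shape in
  which \<open>C_E\<close> and \<open>K_0\<close> are given.\<close>

lemma transpose_block_row_mult: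
  assumes "\<forall>A\<in>set As. dim_row A = r" "v \<in> carrier_vec r"
  shows "transpose_mat (block_row r As) *\<^sub>v v = concat_vec (map (\<lambda>A. transpose_mat A *\<^sub>v v) As)"
  using assms(1)
proof (induction As)
  case Nil
  then show ?case using assms(2) by (auto simp: block_row_simps intro!: eq_vecI)
next
  case (Cons A As)
  let ?B = "block_row r As"
  have A: "dim_row A = r" using Cons.prems by simp
  have c: "dim_row ?B = r"
    by (rule carrier_matD(1)[OF block_row_carrier]) (use Cons.prems in simp)
  have cols: "col (block_row r (A # As)) i = (if i < dim_col A then col A i else col ?B (i - dim_col A))"
    if "i < dim_col A + dim_col ?B" for i
    unfolding block_row_simps using that A c by (rule col_four_block_row)
  have "transpose_mat (block_row r (A # As)) *\<^sub>v v =
      transpose_mat A *\<^sub>v v @\<^sub>v transpose_mat ?B *\<^sub>v v"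
  proof (rule eq_vecI)
    fix i assume "i < dim_vec (transpose_mat A *\<^sub>v v @\<^sub>v transpose_mat ?B *\<^sub>v v)"
    then have i: "i < dim_col A + dim_col ?B" by simp
    then have "i < dim_row (transpose_mat (block_row r (A # As)))" by (simp add: block_row_simps)
    then have "(transpose_mat (block_row r (A # As)) *\<^sub>v v) $ i = col (block_row r (A # As)) i \<bullet> v"
      by (simp only: index_mult_mat_vec row_transpose index_transpose_mat)
    then show "(transpose_mat (block_row r (A # As)) *\<^sub>v v) $ i =
        (transpose_mat A *\<^sub>v v @\<^sub>v transpose_mat ?B *\<^sub>v v) $ i"
      unfolding cols[OF i] using i by simp
  qed (simp add: block_row_simps)
  then show ?case using Cons by simp
qed

lemma zero_mat_mult_vec:
  "v \<in> carrier_vec k \<Longrightarrow> 0\<^sub>m h k *\<^sub>v v = (0\<^sub>v h :: 'a :: semiring_0 vec)"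
  by (rule eq_vecI) (auto simp: scalar_prod_def)

lemma diag_block_mat_mult_concat_vec:
  assumes "list_all2 (\<lambda>A v. dim_col A = dim_vec v) As vs"
  shows "diag_block_mat As *\<^sub>v concat_vec vs = concat_vec (map2 (*\<^sub>v) As vs)"
  using assms
proof (induction rule: list_all2_induct)
  case Nil
  then show ?case by (auto intro!: eq_vecI)
next
  case (Cons A As v vs)
  have cols: "map dim_col As = map dim_vec vs"
    using Cons.hyps(2) by (induction rule: list_all2_induct) auto
  have dc: "dim_col (diag_block_mat As) = dim_vec (concat_vec vs)"
    using cols by (simp add: dim_diag_block_mat)
  have "diag_block_mat (A # As) *\<^sub>v concat_vec (v # vs) =
     (A *\<^sub>v v + 0\<^sub>m (dim_row A) (dim_col (diag_block_mat As)) *\<^sub>v concat_vec vs) @\<^sub>v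
     (0\<^sub>m (dim_row (diag_block_mat As)) (dim_col A) *\<^sub>v v + diag_block_mat As *\<^sub>v concat_vec vs)"
    unfolding diag_block_mat.simps Let_def concat_vec_simps
    by (rule four_block_mat_mult_vec[OF _ zero_carrier_mat zero_carrier_mat])
      (use Cons.hyps(1) dc in \<open>auto intro!: carrier_matI carrier_vecI\<close>)
  also have "\<dots> = (A *\<^sub>v v + 0\<^sub>v (dim_row A)) @\<^sub>v
      (0\<^sub>v (dim_row (diag_block_mat As)) + diag_block_mat As *\<^sub>v concat_vec vs)"
    using Cons.hyps(1) dc by (simp only: zero_mat_mult_vec[OF carrier_vecI])
  also have "A *\<^sub>v v + 0\<^sub>v (dim_row A) = A *\<^sub>v v"
    by (rule right_zero_vec) (rule carrier_vecI, rule dim_mult_mat_vec)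
  also have "0\<^sub>v (dim_row (diag_block_mat As)) + diag_block_mat As *\<^sub>v concat_vec vs =
      diag_block_mat As *\<^sub>v concat_vec vs"
    by (rule left_zero_vec) (rule carrier_vecI, rule dim_mult_mat_vec)
  finally show ?case using Cons by simp
qed

text \<open>Serves to apply \<open>D_E\<close> to an arbitrary input that is not presented mode by
  mode: splitting off the part that meets the final zero block is enough.\<close>

lemma diag_block_mat_snoc_zero_mult:
  fixes As :: "real mat list"
  assumes "v \<in> carrier_vec (sum_list (map dim_col As))" "w \<in> carrier_vec k"
  shows "diag_block_mat (As @ [0\<^sub>m h k]) *\<^sub>v (v @\<^sub>v w) = diag_block_mat As *\<^sub>v v @\<^sub>v 0\<^sub>v h"
proof -
  let ?D = "diag_block_mat As"
  have v: "v \<in> carrier_vec (dim_col ?D)" using assms(1) unfolding dim_diag_block_mat .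
  have "diag_block_mat (As @ [0\<^sub>m h k]) *\<^sub>v (v @\<^sub>v w) =
      (?D *\<^sub>v v + 0\<^sub>m (dim_row ?D) k *\<^sub>v w) @\<^sub>v (0\<^sub>m h (dim_col ?D) *\<^sub>v v + 0\<^sub>m h k *\<^sub>v w)"
    unfolding diag_block_mat_last Let_def index_zero_mat
    by (rule four_block_mat_mult_vec[OF _ zero_carrier_mat zero_carrier_mat zero_carrier_mat v assms(2)])
      (rule carrier_matI; rule refl)
  also have "\<dots> = (?D *\<^sub>v v + 0\<^sub>v (dim_row ?D)) @\<^sub>v (0\<^sub>v h + 0\<^sub>v h)"
    unfolding zero_mat_mult_vec[OF v] zero_mat_mult_vec[OF assms(2)] ..
  also have "0\<^sub>v h + 0\<^sub>v h = (0\<^sub>v h :: real vec)"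
    by (rule left_zero_vec) (rule zero_carrier_vec)
  also have "?D *\<^sub>v v + 0\<^sub>v (dim_row ?D) = ?D *\<^sub>v v"
    by (rule right_zero_vec) (rule carrier_vecI, rule dim_mult_mat_vec)
  finally show ?thesis .
qed

lemma append_vec_vNil_right [simp]: "v @\<^sub>v vNil = v"
  by (rule eq_vecI) auto

lemma concat_vec_add:
  "list_all2 (\<lambda>v w. dim_vec v = dim_vec w) vs ws \<Longrightarrow>
    concat_vec vs + concat_vec ws = concat_vec (map2 (+) vs ws)"
proof (induction rule: list_all2_induct)
  case (Cons v vs w ws)
  have "map dim_vec vs = map dim_vec ws"
    using Cons.hyps(2) by (induction rule: list_all2_induct) auto
  then show ?case using Cons.hyps(1) Cons.IH by (simp add: append_vec_add_dim)
qed (auto intro!: eq_vecI)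

lemma smult_mat_mult_vec:
  fixes A :: "'a :: comm_ring_1 mat"
  shows "dim_vec v = dim_col A \<Longrightarrow> (c \<cdot>\<^sub>m A) *\<^sub>v v = c \<cdot>\<^sub>v (A *\<^sub>v v)"
  by (rule eq_vecI) (auto simp: scalar_prod_def sum_distrib_left mult.assoc)

lemma list_all2_imp_ball: "list_all2 (\<lambda>x y. P x \<and> Q x y) xs ys \<Longrightarrow> \<forall>x\<in>set xs. P x"
  by (induction rule: list_all2_induct) auto

lemma map2_map_same: "map2 f (map g xs) (map h xs) = map (\<lambda>x. f (g x) (h x)) xs"
  by (induction xs) auto

lemma list_all2_map_same: "list_all2 P (map g xs) (map h xs) \<longleftrightarrow> (\<forall>x\<in>set xs. P (g x) (h x))"
  by (induction xs) auto

lemma sum_list_modes: "(\<Sum>i\<leftarrow>[2..<Suc l]. f i) = (\<Sum>i=2..l. f i)"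
  by (simp only: interv_sum_list_conv_sum_set_nat set_upt atLeastLessThanSuc_atLeastAtMost)

text \<open>The weights select the active mode. For \<open>j = 1\<close> no summand is selected, as
  befits the reference mode from which all differences are taken.\<close>

lemma sum_delta_mode: "(\<Sum>i=2..l. delta i j * f i) = (if j \<in> {2..l} then f j else 0)"
proof -
  have "(\<Sum>i=2..l. delta i j * f i) = (\<Sum>i=2..l. if i = j then f j else 0)"
    by (rule sum.cong) (auto simp: delta_def)
  then show ?thesis by simp
qed

lemma sum_neg_delta_mode:
  assumes "\<And>i. i \<in> {2..l} \<Longrightarrow> g i = - (delta i j * f i)"
  shows "(\<Sum>i=2..l. g i) = - (if j \<in> {2..l} then f j else 0)"
proof -
  have "(\<Sum>i=2..l. g i) = (\<Sum>i=2..l. - (delta i j * f i))"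
    by (rule sum.cong[OF refl]) (rule assms)
  then show ?thesis by (simp only: sum_negf sum_delta_mode)
qed

section \<open>The envelope system\<close>

locale envelope_setup =
  fixes n m p l :: nat and \<Sigma> :: "nat \<Rightarrow> state_space" and S M T :: "nat \<Rightarrow> real mat"
  assumes sys: "switched_system n m p l \<Sigma>" and dec: "decomposition n l \<Sigma> S M T"
begin

lemma l_ge_1: "l \<ge> 1"
  using sys by (simp add: switched_system_def)

lemma sys_carrier:
  assumes "i \<in> {1..l}"
  shows "sysA (\<Sigma> i) \<in> carrier_mat n n" "sysB (\<Sigma> i) \<in> carrier_mat n m"
    "sysC (\<Sigma> i) \<in> carrier_mat p n" "sysD (\<Sigma> i) \<in> carrier_mat p m"
  using sys assms by (auto simp: switched_system_def is_state_space_def)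

lemma sys1_carrier:
  shows "sysA (\<Sigma> 1) \<in> carrier_mat n n" "sysB (\<Sigma> 1) \<in> carrier_mat n m"
    "sysC (\<Sigma> 1) \<in> carrier_mat p n" "sysD (\<Sigma> 1) \<in> carrier_mat p m"
  using sys_carrier[of 1] l_ge_1 by auto

lemma Delta_carrier:
  assumes "i \<in> {1..l}"
  shows "DeltaA \<Sigma> i \<in> carrier_mat n n" "DeltaB \<Sigma> i \<in> carrier_mat n m"
    "DeltaC \<Sigma> i \<in> carrier_mat p n" "DeltaD \<Sigma> i \<in> carrier_mat p m"
  unfolding DeltaA_def DeltaB_def DeltaC_def DeltaD_def
  by (intro minus_carrier_mat sys_carrier[OF assms])+

lemma dec_carrier:
  assumes "i \<in> {2..l}"
  shows "S i \<in> carrier_mat n (rk n \<Sigma> i)" "M i \<in> carrier_mat (rk n \<Sigma> i) (rk n \<Sigma> i)"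
    "transpose_mat (T i) \<in> carrier_mat (rk n \<Sigma> i) n"
    "T i \<in> carrier_mat n (rk n \<Sigma> i)"
    "DeltaA \<Sigma> i = S i * M i * transpose_mat (T i)"
  using dec assms by (auto simp: decomposition_def)

section \<open>The state equation in closed loop\<close>

definition rank_input :: "nat \<Rightarrow> real vec \<Rightarrow> real vec" where
  "rank_input i x = M i *\<^sub>v (transpose_mat (T i) *\<^sub>v x)"

lemma rank_input_carrier:
  assumes "i \<in> {2..l}" "x \<in> carrier_vec n"
  shows "transpose_mat (T i) *\<^sub>v x \<in> carrier_vec (rk n \<Sigma> i)" "rank_input i x \<in> carrier_vec (rk n \<Sigma> i)"
proof -
  show tx: "transpose_mat (T i) *\<^sub>v x \<in> carrier_vec (rk n \<Sigma> i)"
    by (rule mult_mat_vec_carrier[OF dec_carrier(3)[OF assms(1)] assms(2)])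
  show "rank_input i x \<in> carrier_vec (rk n \<Sigma> i)"
    unfolding rank_input_def by (rule mult_mat_vec_carrier[OF dec_carrier(2)[OF assms(1)] tx])
qed

lemma S_mult_rank_input:
  assumes "i \<in> {2..l}" "x \<in> carrier_vec n"
  shows "S i *\<^sub>v rank_input i x = DeltaA \<Sigma> i *\<^sub>v x"
  unfolding rank_input_def dec_carrier(5)[OF assms(1)]
    assoc_mult_mat_vec[OF mult_carrier_mat[OF dec_carrier(1,2)[OF assms(1)]] dec_carrier(3)[OF assms(1)] assms(2)]
    assoc_mult_mat_vec[OF dec_carrier(1,2)[OF assms(1)] rank_input_carrier(1)[OF assms]] ..

text \<open>The candidate for \<open>u_E\<close> in mode \<open>j\<close>, found by inserting the
  last part of \<open>y_E\<close>, consisting of the vectors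
  \<open>transpose_mat (T i) *\<^sub>v x\<close>, into the feedback law. The zero block of
  \<open>K\<close> leaves only \<open>K_0\<close> in the first \<open>l\<close> blocks.\<close>

definition loop_input :: "nat \<Rightarrow> real vec \<Rightarrow> real vec \<Rightarrow> real vec" where
  "loop_input j x v = concat_vec (v # map (\<lambda>i. (- delta i j) \<cdot>\<^sub>v v) [2..<Suc l] @
     map (\<lambda>i. (- delta i j) \<cdot>\<^sub>v rank_input i x) [2..<Suc l])"

abbreviation E :: state_space where
  "E \<equiv> envelope n l \<Sigma> S T"

text \<open>The identity A1 - (A1 - Aj) = Aj, with a case distinction because mode 1 has no
  difference block. It is applied to all four system matrices.\<close>

lemma subsystem_mult_vec:
  fixes A1 Aj :: "real mat"
  assumes "j \<in> {1..l}" "A1 \<in> carrier_mat r c" "Aj \<in> carrier_mat r c" "v \<in> carrier_vec c"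
    and "k < r" "j = 1 \<Longrightarrow> Aj = A1"
  shows "(A1 *\<^sub>v v) $ k - (if j \<in> {2..l} then ((A1 - Aj) *\<^sub>v v) $ k else 0) = (Aj *\<^sub>v v) $ k"
proof (cases "j = 1")
  case False
  then have "j \<in> {2..l}" using assms(1) by auto
  then show ?thesis
    unfolding minus_mult_distrib_mat_vec[OF assms(2-4)] using assms(2,3,5) by simp
qed (use assms(6) in simp)

text \<open>From \<open>B_E\<close> the deltas retain mode 1 and two corrections: minus
  \<open>DeltaB \<Sigma> j\<close> applied to \<open>v\<close>, and minus
  \<open>DeltaA \<Sigma> j\<close> applied to \<open>x\<close>, the latter recomposed from
  \<open>S j\<close>, \<open>M j\<close> and \<open>T j\<close>. They turn mode 1 into mode
  \<open>j\<close>.\<close>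

lemma envelope_dynamics_loop_input:
  assumes j: "j \<in> {1..l}" and x: "x \<in> carrier_vec n" and v: "v \<in> carrier_vec m"
  shows "sysA E *\<^sub>v x + sysB E *\<^sub>v loop_input j x v = sysA (\<Sigma> j) *\<^sub>v x + sysB (\<Sigma> j) *\<^sub>v v"
proof (rule eq_vecI)
  let ?Bs = "[sysB (\<Sigma> 1)] @ map (DeltaB \<Sigma>) [2..<Suc l] @ map S [2..<Suc l]"
  let ?us = "v # map (\<lambda>i. (- delta i j) \<cdot>\<^sub>v v) [2..<Suc l] @
     map (\<lambda>i. (- delta i j) \<cdot>\<^sub>v rank_input i x) [2..<Suc l]"
  have B: "sysB E = block_row n ?Bs" and A: "sysA E = sysA (\<Sigma> 1)" by (simp_all add: envelope_def)
  have dims: "list_all2 (\<lambda>A v. dim_row A = n \<and> dim_col A = dim_vec v) ?Bs ?us"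
  proof -
    have "dim_row (DeltaB \<Sigma> i) = n \<and> dim_col (DeltaB \<Sigma> i) = dim_vec ((- delta i j) \<cdot>\<^sub>v v)"
      "dim_row (S i) = n \<and> dim_col (S i) = dim_vec ((- delta i j) \<cdot>\<^sub>v rank_input i x)"
      if "i \<in> set [2..<Suc l]" for i
    proof -
      have i: "i \<in> {1..l}" "i \<in> {2..l}" using that by auto
      show "dim_row (DeltaB \<Sigma> i) = n \<and> dim_col (DeltaB \<Sigma> i) = dim_vec ((- delta i j) \<cdot>\<^sub>v v)"
        using carrier_matD[OF Delta_carrier(2)[OF i(1)]] carrier_vecD[OF v] by simp
      show "dim_row (S i) = n \<and> dim_col (S i) = dim_vec ((- delta i j) \<cdot>\<^sub>v rank_input i x)"
        using carrier_matD[OF dec_carrier(1)[OF i(2)]] carrier_vecD[OF rank_input_carrier(2)[OF i(2) x]] by simp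
    qed
    then show ?thesis
      using carrier_matD[OF sys1_carrier(2)] carrier_vecD[OF v]
      by (auto simp del: upt_Suc simp: list_all2_map_same list_all2_append)
  qed
  have rows: "\<forall>A\<in>set ?Bs. dim_row A = n"
    by (rule list_all2_imp_ball[OF dims])
  have dimB: "dim_row (sysB E) = n"
    unfolding B by (rule carrier_matD(1)[OF block_row_carrier[OF rows]])
  show "dim_vec (sysA E *\<^sub>v x + sysB E *\<^sub>v loop_input j x v) =
      dim_vec (sysA (\<Sigma> j) *\<^sub>v x + sysB (\<Sigma> j) *\<^sub>v v)"
    using dimB carrier_matD[OF sys_carrier(2)[OF j]] by simp
  fix k assume "k < dim_vec (sysA (\<Sigma> j) *\<^sub>v x + sysB (\<Sigma> j) *\<^sub>v v)"
  then have k: "k < n" using carrier_matD[OF sys_carrier(2)[OF j]] by simp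
  have DB: "(DeltaB \<Sigma> i *\<^sub>v ((- delta i j) \<cdot>\<^sub>v v)) $ k = - (delta i j * (DeltaB \<Sigma> i *\<^sub>v v) $ k)"
    and DS: "(S i *\<^sub>v ((- delta i j) \<cdot>\<^sub>v rank_input i x)) $ k = - (delta i j * (DeltaA \<Sigma> i *\<^sub>v x) $ k)"
    if "i \<in> {2..l}" for i
  proof -
    have i: "i \<in> {1..l}" using that by simp
    show "(DeltaB \<Sigma> i *\<^sub>v ((- delta i j) \<cdot>\<^sub>v v)) $ k = - (delta i j * (DeltaB \<Sigma> i *\<^sub>v v) $ k)"
      unfolding mult_mat_vec[OF Delta_carrier(2)[OF i] v]
      using k carrier_matD[OF Delta_carrier(2)[OF i]] by simp
    show "(S i *\<^sub>v ((- delta i j) \<cdot>\<^sub>v rank_input i x)) $ k = - (delta i j * (DeltaA \<Sigma> i *\<^sub>v x) $ k)"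
      unfolding mult_mat_vec[OF dec_carrier(1)[OF that] rank_input_carrier(2)[OF that x]] S_mult_rank_input[OF that x]
      using k carrier_matD[OF Delta_carrier(1)[OF i]] by simp
  qed
  have "(sysB E *\<^sub>v loop_input j x v) $ k = (\<Sum>(A, w)\<leftarrow>zip ?Bs ?us. (A *\<^sub>v w) $ k)"
    unfolding B loop_input_def by (rule block_row_mult_concat_vec[OF dims k])
  also have "\<dots> = (sysB (\<Sigma> 1) *\<^sub>v v) $ k +
      ((\<Sum>i=2..l. (DeltaB \<Sigma> i *\<^sub>v ((- delta i j) \<cdot>\<^sub>v v)) $ k) +
       (\<Sum>i=2..l. (S i *\<^sub>v ((- delta i j) \<cdot>\<^sub>v rank_input i x)) $ k))"
    by (simp add: map2_map_same sum_list_modes del: upt_Suc)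
  also have "(\<Sum>i=2..l. (DeltaB \<Sigma> i *\<^sub>v ((- delta i j) \<cdot>\<^sub>v v)) $ k) =
      - (if j \<in> {2..l} then (DeltaB \<Sigma> j *\<^sub>v v) $ k else 0)"
    by (rule sum_neg_delta_mode[where f = "\<lambda>i. (DeltaB \<Sigma> i *\<^sub>v v) $ k"]) (rule DB)
  also have "(\<Sum>i=2..l. (S i *\<^sub>v ((- delta i j) \<cdot>\<^sub>v rank_input i x)) $ k) =
      - (if j \<in> {2..l} then (DeltaA \<Sigma> j *\<^sub>v x) $ k else 0)"
    by (rule sum_neg_delta_mode[where f = "\<lambda>i. (DeltaA \<Sigma> i *\<^sub>v x) $ k"]) (rule DS)
  finally have "(sysA E *\<^sub>v x) $ k + (sysB E *\<^sub>v loop_input j x v) $ k =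
      ((sysA (\<Sigma> 1) *\<^sub>v x) $ k - (if j \<in> {2..l} then (DeltaA \<Sigma> j *\<^sub>v x) $ k else 0)) +
      ((sysB (\<Sigma> 1) *\<^sub>v v) $ k - (if j \<in> {2..l} then (DeltaB \<Sigma> j *\<^sub>v v) $ k else 0))"
    unfolding A by linarith
  also have "\<dots> = (sysA (\<Sigma> j) *\<^sub>v x) $ k + (sysB (\<Sigma> j) *\<^sub>v v) $ k"
    unfolding DeltaA_def DeltaB_def
    using subsystem_mult_vec[OF j sys1_carrier(1) sys_carrier(1)[OF j] x k]
      subsystem_mult_vec[OF j sys1_carrier(2) sys_carrier(2)[OF j] v k] by simp
  finally show "(sysA E *\<^sub>v x + sysB E *\<^sub>v loop_input j x v) $ k =
      (sysA (\<Sigma> j) *\<^sub>v x + sysB (\<Sigma> j) *\<^sub>v v) $ k"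
    using k dimB carrier_matD[OF sys_carrier(2)[OF j]] by simp
qed

section \<open>Output blocks of the envelope and their recombination\<close>

lemma sysC_envelope_mult:
  assumes "x \<in> carrier_vec n"
  shows "sysC E *\<^sub>v x = concat_vec (sysC (\<Sigma> 1) *\<^sub>v x # map (\<lambda>i. DeltaC \<Sigma> i *\<^sub>v x) [2..<Suc l] @
    [concat_vec (map (\<lambda>i. transpose_mat (T i) *\<^sub>v x) [2..<Suc l])])"
proof -
  have "dim_row (transpose_mat (DeltaC \<Sigma> i)) = n \<and> dim_row (T i) = n" if "i \<in> {2..l}" for i
    using that carrier_matD[OF Delta_carrier(3), of i] carrier_matD[OF dec_carrier(4), of i] by simp
  then have rows: "\<forall>A\<in>set ([transpose_mat (sysC (\<Sigma> 1))] @
      map (\<lambda>i. transpose_mat (DeltaC \<Sigma> i)) [2..<Suc l] @ map T [2..<Suc l]). dim_row A = n"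
    using carrier_matD[OF sys1_carrier(3)] by (auto simp del: upt_Suc)
  have "sysC E *\<^sub>v x = concat_vec (map (\<lambda>A. transpose_mat A *\<^sub>v x) ([transpose_mat (sysC (\<Sigma> 1))] @
      map (\<lambda>i. transpose_mat (DeltaC \<Sigma> i)) [2..<Suc l] @ map T [2..<Suc l]))"
    using transpose_block_row_mult[OF rows assms] by (simp add: envelope_def del: upt_Suc)
  also have "\<dots> = concat_vec ((sysC (\<Sigma> 1) *\<^sub>v x # map (\<lambda>i. DeltaC \<Sigma> i *\<^sub>v x) [2..<Suc l]) @
      map (\<lambda>i. transpose_mat (T i) *\<^sub>v x) [2..<Suc l])"
    by (simp add: comp_def del: upt_Suc)
  \<comment> \<open>The products with the \<open>T i\<close> are gathered into one last block,
    matching the single zero block of size \<open>rk_sum n l \<Sigma>\<close> in \<open>fbC0\<close>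
    and \<open>D_E\<close>.\<close>
  finally show ?thesis
    by (simp only: concat_vec_append append_Cons concat_vec_simps append_vec_vNil_right)
qed

text \<open>The leading \<open>d\<close> is the block of mode 1; with \<open>l = 0\<close> the count
  would be off by this block.\<close>

lemma sum_list_modes_const: "d + (\<Sum>i\<leftarrow>[2..<Suc l]. d) = l * (d :: nat)"
  using l_ge_1 by (cases l) (auto simp: sum_list_triv simp del: upt_Suc)

lemma sum_list_rk: "(\<Sum>i\<leftarrow>[2..<Suc l]. rk n \<Sigma> i) = rk_sum n l \<Sigma>"
  unfolding rk_sum_def by (rule sum_list_modes)

lemma concat_vec_modes_carrier:
  assumes "dim_vec w = d" "\<And>i. i \<in> {2..l} \<Longrightarrow> dim_vec (f i) = d"
  shows "concat_vec (w # map f [2..<Suc l]) \<in> carrier_vec (l * d)"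
proof (rule carrier_vecI)
  have "dim_vec (concat_vec (w # map f [2..<Suc l])) = d + (\<Sum>i\<leftarrow>[2..<Suc l]. dim_vec (f i))"
    using assms(1) by (simp add: comp_def del: upt_Suc)
  also have "(\<Sum>i\<leftarrow>[2..<Suc l]. dim_vec (f i)) = (\<Sum>i\<leftarrow>[2..<Suc l]. d)"
    by (rule arg_cong[where f = sum_list], rule map_cong) (use assms(2) in auto)
  finally show "dim_vec (concat_vec (w # map f [2..<Suc l])) = l * d"
    by (simp only: sum_list_modes_const)
qed

lemma concat_vec_rk_carrier:
  assumes "\<And>i. i \<in> {2..l} \<Longrightarrow> f i \<in> carrier_vec (rk n \<Sigma> i)"
  shows "concat_vec (map f [2..<Suc l]) \<in> carrier_vec (rk_sum n l \<Sigma>)"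
proof (rule carrier_vecI)
  have "dim_vec (concat_vec (map f [2..<Suc l])) = (\<Sum>i\<leftarrow>[2..<Suc l]. dim_vec (f i))"
    by (simp add: comp_def del: upt_Suc)
  also have "\<dots> = (\<Sum>i\<leftarrow>[2..<Suc l]. rk n \<Sigma> i)"
    by (rule arg_cong[where f = sum_list], rule map_cong) (use assms in auto)
  finally show "dim_vec (concat_vec (map f [2..<Suc l])) = rk_sum n l \<Sigma>"
    by (simp only: sum_list_rk)
qed

lemma fbC0_mult:
  assumes w0: "w0 \<in> carrier_vec p" and f: "\<And>i. i \<in> {2..l} \<Longrightarrow> f i \<in> carrier_vec p"
    and w: "w \<in> carrier_vec (rk_sum n l \<Sigma>)"
  shows "fbC0 n p l \<Sigma> j *\<^sub>v concat_vec (w0 # map f [2..<Suc l] @ [w]) =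
    w0 - (if j \<in> {2..l} then f j else 0\<^sub>v p)"
proof (rule eq_vecI)
  let ?Cs = "[1\<^sub>m p] @ map (\<lambda>i. (- delta i j) \<cdot>\<^sub>m 1\<^sub>m p) [2..<Suc l] @ [0\<^sub>m p (rk_sum n l \<Sigma>)]"
  let ?ws = "w0 # map f [2..<Suc l] @ [w]"
  have "\<forall>i\<in>set [2..<Suc l]. dim_vec (f i) = p" using carrier_vecD[OF f] by auto
  then have dims: "list_all2 (\<lambda>A v. dim_row A = p \<and> dim_col A = dim_vec v) ?Cs ?ws"
    using carrier_vecD[OF w0] carrier_vecD[OF w]
    by (simp add: list_all2_append list_all2_map_same del: upt_Suc)
  have row: "dim_row (fbC0 n p l \<Sigma> j) = p"
    unfolding fbC0_def by (rule carrier_matD(1)[OF block_row_carrier[OF list_all2_imp_ball[OF dims]]])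
  have "dim_vec (w0 - (if j \<in> {2..l} then f j else 0\<^sub>v p)) = p"
    using carrier_vecD[OF f] by simp
  then show "dim_vec (fbC0 n p l \<Sigma> j *\<^sub>v concat_vec ?ws) =
      dim_vec (w0 - (if j \<in> {2..l} then f j else 0\<^sub>v p))"
    using row by simp
  fix k assume "k < dim_vec (w0 - (if j \<in> {2..l} then f j else 0\<^sub>v p))"
  then have k: "k < p" using carrier_vecD[OF f] by (simp split: if_splits)
  have one: "(((- delta i j) \<cdot>\<^sub>m 1\<^sub>m p) *\<^sub>v f i) $ k = - (delta i j * f i $ k)" if "i \<in> {2..l}" for i
    using smult_mat_mult_vec[of "f i" "1\<^sub>m p" "- delta i j"] f[OF that] k by simp
  have "(fbC0 n p l \<Sigma> j *\<^sub>v concat_vec ?ws) $ k = (\<Sum>(A, w)\<leftarrow>zip ?Cs ?ws. (A *\<^sub>v w) $ k)"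
    unfolding fbC0_def by (rule block_row_mult_concat_vec[OF dims k])
  also have "\<dots> = w0 $ k + (\<Sum>i=2..l. (((- delta i j) \<cdot>\<^sub>m 1\<^sub>m p) *\<^sub>v f i) $ k)"
    using w0 w k by (simp add: map2_map_same sum_list_modes zero_mat_mult_vec del: upt_Suc)
  also have "(\<Sum>i=2..l. (((- delta i j) \<cdot>\<^sub>m 1\<^sub>m p) *\<^sub>v f i) $ k) =
      - (if j \<in> {2..l} then f j $ k else 0)"
    by (rule sum_neg_delta_mode[where f = "\<lambda>i. f i $ k"]) (rule one)
  finally show "(fbC0 n p l \<Sigma> j *\<^sub>v concat_vec ?ws) $ k =
      (w0 - (if j \<in> {2..l} then f j else 0\<^sub>v p)) $ k"
    using k carrier_vecD[OF f] by simp
qed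

lemma loop_input_split:
  "loop_input j x v = concat_vec (v # map (\<lambda>i. (- delta i j) \<cdot>\<^sub>v v) [2..<Suc l]) @\<^sub>v
     concat_vec (map (\<lambda>i. (- delta i j) \<cdot>\<^sub>v rank_input i x) [2..<Suc l])"
  unfolding loop_input_def by (simp only: concat_vec_append concat_vec_simps append_vec_assoc)

text \<open>The value of \<open>y_E\<close> under \<open>loop_input\<close>. The minus sign of the
  difference blocks in \<open>D_E\<close> meets the one in \<open>loop_input\<close>, so the
  \<open>DeltaD\<close> terms appear with a plus, like the \<open>DeltaC\<close> terms.\<close>

definition loop_output :: "nat \<Rightarrow> real vec \<Rightarrow> real vec \<Rightarrow> real vec" where
  "loop_output j x v = concat_vec ((sysC (\<Sigma> 1) *\<^sub>v x + sysD (\<Sigma> 1) *\<^sub>v v) #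
     map (\<lambda>i. DeltaC \<Sigma> i *\<^sub>v x + delta i j \<cdot>\<^sub>v (DeltaD \<Sigma> i *\<^sub>v v)) [2..<Suc l] @
     [concat_vec (map (\<lambda>i. transpose_mat (T i) *\<^sub>v x) [2..<Suc l])])"

text \<open>\<open>fbC0\<close> subtracts the block of mode \<open>j\<close>, if there is one, from
  the first block, and this removes both the \<open>C\<close> and the \<open>D\<close>
  difference.\<close>

lemma fbC0_loop_output:
  assumes j: "j \<in> {1..l}" and x: "x \<in> carrier_vec n" and v: "v \<in> carrier_vec m"
  shows "fbC0 n p l \<Sigma> j *\<^sub>v loop_output j x v = sysC (\<Sigma> j) *\<^sub>v x + sysD (\<Sigma> j) *\<^sub>v v"
proof -
  note Cx = mult_mat_vec_carrier[OF Delta_carrier(3) x] and Dv = mult_mat_vec_carrier[OF Delta_carrier(4) v]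
  note Cx1 = mult_mat_vec_carrier[OF sys1_carrier(3) x] and Dv1 = mult_mat_vec_carrier[OF sys1_carrier(4) v]
  note Dvj = mult_mat_vec_carrier[OF sys_carrier(4)[OF j] v]
  have "fbC0 n p l \<Sigma> j *\<^sub>v loop_output j x v = sysC (\<Sigma> 1) *\<^sub>v x + sysD (\<Sigma> 1) *\<^sub>v v -
      (if j \<in> {2..l} then DeltaC \<Sigma> j *\<^sub>v x + delta j j \<cdot>\<^sub>v (DeltaD \<Sigma> j *\<^sub>v v) else 0\<^sub>v p)"
    unfolding loop_output_def
  proof (rule fbC0_mult)
    show "sysC (\<Sigma> 1) *\<^sub>v x + sysD (\<Sigma> 1) *\<^sub>v v \<in> carrier_vec p"
      by (rule add_carrier_vec[OF Cx1 Dv1])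
    show "concat_vec (map (\<lambda>i. transpose_mat (T i) *\<^sub>v x) [2..<Suc l]) \<in> carrier_vec (rk_sum n l \<Sigma>)"
      by (rule concat_vec_rk_carrier) (rule rank_input_carrier(1)[OF _ x])
    fix i assume "i \<in> {2..l}"
    then have i: "i \<in> {1..l}" by simp
    show "DeltaC \<Sigma> i *\<^sub>v x + delta i j \<cdot>\<^sub>v (DeltaD \<Sigma> i *\<^sub>v v) \<in> carrier_vec p"
      using Cx[OF i] Dv[OF i] by simp
  qed
  also have "\<dots> = sysC (\<Sigma> j) *\<^sub>v x + sysD (\<Sigma> j) *\<^sub>v v"
  proof (rule eq_vecI)
    show "dim_vec (sysC (\<Sigma> 1) *\<^sub>v x + sysD (\<Sigma> 1) *\<^sub>v v -
        (if j \<in> {2..l} then DeltaC \<Sigma> j *\<^sub>v x + delta j j \<cdot>\<^sub>v (DeltaD \<Sigma> j *\<^sub>v v) else 0\<^sub>v p)) =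
        dim_vec (sysC (\<Sigma> j) *\<^sub>v x + sysD (\<Sigma> j) *\<^sub>v v)"
      using carrier_vecD[OF Dv[OF j]] carrier_vecD[OF Dvj] by simp
    fix k assume "k < dim_vec (sysC (\<Sigma> j) *\<^sub>v x + sysD (\<Sigma> j) *\<^sub>v v)"
    then have k: "k < p" using carrier_vecD[OF Dvj] by simp
    have "(sysC (\<Sigma> 1) *\<^sub>v x + sysD (\<Sigma> 1) *\<^sub>v v -
        (if j \<in> {2..l} then DeltaC \<Sigma> j *\<^sub>v x + delta j j \<cdot>\<^sub>v (DeltaD \<Sigma> j *\<^sub>v v) else 0\<^sub>v p)) $ k =
        ((sysC (\<Sigma> 1) *\<^sub>v x) $ k - (if j \<in> {2..l} then (DeltaC \<Sigma> j *\<^sub>v x) $ k else 0)) +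
        ((sysD (\<Sigma> 1) *\<^sub>v v) $ k - (if j \<in> {2..l} then (DeltaD \<Sigma> j *\<^sub>v v) $ k else 0))"
      using k carrier_vecD[OF Dv[OF j]] carrier_vecD[OF Cx[OF j]] carrier_vecD[OF Cx1] carrier_vecD[OF Dv1]
      by (simp add: delta_def del: index_mult_mat_vec)
    also have "\<dots> = (sysC (\<Sigma> j) *\<^sub>v x) $ k + (sysD (\<Sigma> j) *\<^sub>v v) $ k"
      unfolding DeltaC_def DeltaD_def
      using subsystem_mult_vec[OF j sys1_carrier(3) sys_carrier(3)[OF j] x k]
        subsystem_mult_vec[OF j sys1_carrier(4) sys_carrier(4)[OF j] v k] by simp
    finally show "(sysC (\<Sigma> 1) *\<^sub>v x + sysD (\<Sigma> 1) *\<^sub>v v -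
        (if j \<in> {2..l} then DeltaC \<Sigma> j *\<^sub>v x + delta j j \<cdot>\<^sub>v (DeltaD \<Sigma> j *\<^sub>v v) else 0\<^sub>v p)) $ k =
        (sysC (\<Sigma> j) *\<^sub>v x + sysD (\<Sigma> j) *\<^sub>v v) $ k"
      using k carrier_vecD[OF Dvj] by (simp del: index_mult_mat_vec)
  qed
  finally show ?thesis .
qed

section \<open>The algebraic loop\<close>

lemma sysD_envelope:
  "sysD E = diag_block_mat ((sysD (\<Sigma> 1) # map (\<lambda>i. - DeltaD \<Sigma> i) [2..<Suc l]) @
     [0\<^sub>m (rk_sum n l \<Sigma>) (rk_sum n l \<Sigma>)])"
  by (simp add: envelope_def del: upt_Suc)

lemma DeltaD_dims: "i \<in> {2..l} \<Longrightarrow> dim_row (DeltaD \<Sigma> i) = p \<and> dim_col (DeltaD \<Sigma> i) = m"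
  using carrier_matD[OF Delta_carrier(4), of i] by simp

lemma sysD_envelope_dims:
  "(\<Sum>A\<leftarrow>sysD (\<Sigma> 1) # map (\<lambda>i. - DeltaD \<Sigma> i) [2..<Suc l]. dim_row A) = l * p"
  "(\<Sum>A\<leftarrow>sysD (\<Sigma> 1) # map (\<lambda>i. - DeltaD \<Sigma> i) [2..<Suc l]. dim_col A) = l * m"
proof -
  have rows: "(\<Sum>i\<leftarrow>[2..<Suc l]. dim_row (DeltaD \<Sigma> i)) = (\<Sum>i\<leftarrow>[2..<Suc l]. p)"
    and cols: "(\<Sum>i\<leftarrow>[2..<Suc l]. dim_col (DeltaD \<Sigma> i)) = (\<Sum>i\<leftarrow>[2..<Suc l]. m)"
    by (rule arg_cong[where f = sum_list], rule map_cong, rule refl, use DeltaD_dims in force)+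
  show "(\<Sum>A\<leftarrow>sysD (\<Sigma> 1) # map (\<lambda>i. - DeltaD \<Sigma> i) [2..<Suc l]. dim_row A) = l * p"
    using carrier_matD[OF sys1_carrier(4)] sum_list_modes_const[of p]
    by (simp add: comp_def rows del: upt_Suc)
  show "(\<Sum>A\<leftarrow>sysD (\<Sigma> 1) # map (\<lambda>i. - DeltaD \<Sigma> i) [2..<Suc l]. dim_col A) = l * m"
    using carrier_matD[OF sys1_carrier(4)] sum_list_modes_const[of m]
    by (simp add: comp_def cols del: upt_Suc)
qed

text \<open>
  The last block of \<open>y\<^sub>E\<close> does not depend on \<open>u\<^sub>E\<close>, and \<open>K\<close> only reads that block: hence the
  algebraic loop is solved by \<^const>\<open>loop_input\<close>, and by nothing else.
\<close>
lemma feedback_eq_loop_input: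
  assumes x: "x \<in> carrier_vec n" and v: "v \<in> carrier_vec m"
    and uE: "uE \<in> carrier_vec (l * m + rk_sum n l \<Sigma>)"
  shows "fbK m p l M j *\<^sub>v (sysC E *\<^sub>v x + sysD E *\<^sub>v uE) + fbK0 n m l \<Sigma> j *\<^sub>v v = loop_input j x v"
proof -
  let ?L = "rk_sum n l \<Sigma>" and ?ms = "[2..<Suc l]"
  let ?Ds = "sysD (\<Sigma> 1) # map (\<lambda>i. - DeltaD \<Sigma> i) ?ms"
  \<comment> \<open>Nothing but the dimension of \<open>uE\<close> is known here, so it is merely
    cut where the zero block of \<open>D_E\<close> begins.\<close>
  define a where "a = vec_first uE (l * m)"
  define b where "b = vec_last uE ?L"
  have ab: "uE = a @\<^sub>v b" and a: "a \<in> carrier_vec (l * m)" and b: "b \<in> carrier_vec ?L"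
    using vec_first_last_append[OF uE] by (simp_all add: a_def b_def)
  define c0 where "c0 = concat_vec (sysC (\<Sigma> 1) *\<^sub>v x # map (\<lambda>i. DeltaC \<Sigma> i *\<^sub>v x) ?ms)"
  define w where "w = concat_vec (map (\<lambda>i. transpose_mat (T i) *\<^sub>v x) ?ms)"
  define d where "d = diag_block_mat ?Ds *\<^sub>v a"
  have w: "w \<in> carrier_vec ?L"
    unfolding w_def by (rule concat_vec_rk_carrier) (rule rank_input_carrier(1)[OF _ x])
  have c0: "c0 \<in> carrier_vec (l * p)"
    unfolding c0_def
    by (rule concat_vec_modes_carrier)
      (use carrier_matD[OF sys1_carrier(3)] carrier_matD[OF Delta_carrier(3)] in auto)
  have d: "d \<in> carrier_vec (l * p)"
    by (rule carrier_vecI)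
      (simp only: d_def dim_mult_mat_vec dim_diag_block_mat sysD_envelope_dims)
  have "sysC E *\<^sub>v x = c0 @\<^sub>v w"
    unfolding sysC_envelope_mult[OF x] c0_def w_def
    by (simp only: concat_vec_append concat_vec_simps append_vec_vNil_right append_vec_assoc)
  moreover have "sysD E *\<^sub>v uE = d @\<^sub>v 0\<^sub>v ?L"
    unfolding sysD_envelope ab d_def
    by (rule diag_block_mat_snoc_zero_mult[OF _ b]) (simp only: sysD_envelope_dims a)
  ultimately have "sysC E *\<^sub>v x + sysD E *\<^sub>v uE = (c0 + d) @\<^sub>v (w + 0\<^sub>v ?L)"
    using append_vec_add[OF c0 d w zero_carrier_vec] by simp
  also have "\<dots> = concat_vec ((c0 + d) # map (\<lambda>i. transpose_mat (T i) *\<^sub>v x) ?ms)"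
    unfolding right_zero_vec[OF w] by (simp only: concat_vec_simps w_def)
  finally have yE: "sysC E *\<^sub>v x + sysD E *\<^sub>v uE =
      concat_vec ((c0 + d) # map (\<lambda>i. transpose_mat (T i) *\<^sub>v x) ?ms)" .
  have cd: "c0 + d \<in> carrier_vec (l * p)" by (rule add_carrier_vec[OF c0 d])
  have MT: "dim_col (M i) = dim_vec (transpose_mat (T i) *\<^sub>v x)" if "i \<in> {2..l}" for i
    using carrier_matD[OF dec_carrier(2)[OF that]] carrier_vecD[OF rank_input_carrier(1)[OF that x]] by simp
  have "fbK m p l M j *\<^sub>v (sysC E *\<^sub>v x + sysD E *\<^sub>v uE) =
      concat_vec (0\<^sub>m (l * m) (l * p) *\<^sub>v (c0 + d) #
        map (\<lambda>i. ((- delta i j) \<cdot>\<^sub>m M i) *\<^sub>v (transpose_mat (T i) *\<^sub>v x)) ?ms)"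
    unfolding yE fbK_def
    by (subst diag_block_mat_mult_concat_vec)
      (use MT carrier_vecD[OF cd] in \<open>simp_all add: list_all2_map_same map2_map_same del: upt_Suc\<close>)
  also have "map (\<lambda>i. ((- delta i j) \<cdot>\<^sub>m M i) *\<^sub>v (transpose_mat (T i) *\<^sub>v x)) ?ms =
      map (\<lambda>i. (- delta i j) \<cdot>\<^sub>v rank_input i x) ?ms"
    using smult_mat_mult_vec[OF MT[symmetric]] by (simp add: rank_input_def del: upt_Suc)
  \<comment> \<open>Here \<open>uE\<close> disappears: it enters only through \<open>d\<close>,
    which lies in the part annihilated by the zero block of \<open>K\<close>.\<close>
  also have "0\<^sub>m (l * m) (l * p) *\<^sub>v (c0 + d) = 0\<^sub>v (l * m)"
    by (rule zero_mat_mult_vec[OF cd])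
  finally have K: "fbK m p l M j *\<^sub>v (sysC E *\<^sub>v x + sysD E *\<^sub>v uE) =
      0\<^sub>v (l * m) @\<^sub>v concat_vec (map (\<lambda>i. (- delta i j) \<cdot>\<^sub>v rank_input i x) ?ms)" by simp
  let ?As = "[1\<^sub>m m] @ map (\<lambda>i. (- delta i j) \<cdot>\<^sub>m 1\<^sub>m m) ?ms @ [0\<^sub>m m ?L]"
  have rows: "\<forall>A\<in>set ?As. dim_row A = m" by (auto simp del: upt_Suc)
  have tr: "transpose_mat ((- delta i j) \<cdot>\<^sub>m 1\<^sub>m m) *\<^sub>v v = (- delta i j) \<cdot>\<^sub>v v" for i
  proof -
    have "transpose_mat ((- delta i j) \<cdot>\<^sub>m 1\<^sub>m m) = (- delta i j) \<cdot>\<^sub>m 1\<^sub>m m"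
      by (rule eq_matI) auto
    then show ?thesis using smult_mat_mult_vec[of v "1\<^sub>m m" "- delta i j"] v by simp
  qed
  have "fbK0 n m l \<Sigma> j *\<^sub>v v = concat_vec (map (\<lambda>A. transpose_mat A *\<^sub>v v) ?As)"
    unfolding fbK0_def by (rule transpose_block_row_mult[OF rows v])
  also have "\<dots> = concat_vec ((v # map (\<lambda>i. (- delta i j) \<cdot>\<^sub>v v) ?ms) @ [0\<^sub>v ?L])"
    using v by (simp add: comp_def tr zero_mat_mult_vec del: upt_Suc)
  also have "\<dots> = concat_vec (v # map (\<lambda>i. (- delta i j) \<cdot>\<^sub>v v) ?ms) @\<^sub>v 0\<^sub>v ?L"
    by (simp only: concat_vec_append concat_vec_simps append_vec_vNil_right)
  finally have K0: "fbK0 n m l \<Sigma> j *\<^sub>v v =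
      concat_vec (v # map (\<lambda>i. (- delta i j) \<cdot>\<^sub>v v) ?ms) @\<^sub>v 0\<^sub>v ?L" .
  have vs: "concat_vec (v # map (\<lambda>i. (- delta i j) \<cdot>\<^sub>v v) ?ms) \<in> carrier_vec (l * m)"
    by (rule concat_vec_modes_carrier) (use carrier_vecD[OF v] in auto)
  have ws: "concat_vec (map (\<lambda>i. (- delta i j) \<cdot>\<^sub>v rank_input i x) ?ms) \<in> carrier_vec ?L"
    by (rule concat_vec_rk_carrier) (simp only: smult_carrier_vec rank_input_carrier(2)[OF _ x])
  show ?thesis
    unfolding K K0 append_vec_add[OF zero_carrier_vec vs ws zero_carrier_vec]
      left_zero_vec[OF vs] right_zero_vec[OF ws] loop_input_split ..
qed

lemma loop_input_carrier:
  assumes "x \<in> carrier_vec n" "v \<in> carrier_vec m"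
  shows "loop_input j x v \<in> carrier_vec (l * m + rk_sum n l \<Sigma>)"
  unfolding loop_input_split
proof (rule append_carrier_vec)
  show "concat_vec (v # map (\<lambda>i. (- delta i j) \<cdot>\<^sub>v v) [2..<Suc l]) \<in> carrier_vec (l * m)"
    by (rule concat_vec_modes_carrier) (use carrier_vecD[OF assms(2)] in auto)
  show "concat_vec (map (\<lambda>i. (- delta i j) \<cdot>\<^sub>v rank_input i x) [2..<Suc l]) \<in> carrier_vec (rk_sum n l \<Sigma>)"
    by (rule concat_vec_rk_carrier) (simp only: smult_carrier_vec rank_input_carrier(2)[OF _ assms(1)])
qed

text \<open>A vector sum takes its dimension from the second summand, so counting the rows of
  \<open>K_0\<close> suffices. It supplies the dimension of \<open>uE\<close>, on which
  \<open>closed_loop_output\<close> imposes no explicit condition.\<close>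

lemma feedback_carrier:
  "fbK m p l M j *\<^sub>v w + fbK0 n m l \<Sigma> j *\<^sub>v v \<in> carrier_vec (l * m + rk_sum n l \<Sigma>)"
proof (rule carrier_vecI)
  let ?As = "[1\<^sub>m m] @ map (\<lambda>i. (- delta i j) \<cdot>\<^sub>m 1\<^sub>m m) [2..<Suc l] @ [0\<^sub>m m (rk_sum n l \<Sigma>)]"
  have rows: "\<forall>A\<in>set ?As. dim_row A = m" by (auto simp del: upt_Suc)
  have "dim_row (fbK0 n m l \<Sigma> j) = sum_list (map dim_col ?As)"
    unfolding fbK0_def index_transpose_mat by (rule carrier_matD(2)[OF block_row_carrier[OF rows]])
  also have "\<dots> = l * m + rk_sum n l \<Sigma>"
    using sum_list_modes_const[of m] by (simp add: comp_def del: upt_Suc)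
  finally show "dim_vec (fbK m p l M j *\<^sub>v w + fbK0 n m l \<Sigma> j *\<^sub>v v) = l * m + rk_sum n l \<Sigma>"
    by simp
qed

lemma envelope_output_loop_input:
  assumes x: "x \<in> carrier_vec n" and v: "v \<in> carrier_vec m"
  shows "sysC E *\<^sub>v x + sysD E *\<^sub>v loop_input j x v = loop_output j x v"
proof -
  let ?L = "rk_sum n l \<Sigma>" and ?ms = "[2..<Suc l]"
  let ?Ds = "sysD (\<Sigma> 1) # map (\<lambda>i. - DeltaD \<Sigma> i) ?ms @ [0\<^sub>m ?L ?L]"
  define w where "w = concat_vec (map (\<lambda>i. (- delta i j) \<cdot>\<^sub>v rank_input i x) ?ms)"
  define z where "z = concat_vec (map (\<lambda>i. transpose_mat (T i) *\<^sub>v x) ?ms)"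
  have w: "w \<in> carrier_vec ?L"
    unfolding w_def by (rule concat_vec_rk_carrier) (simp only: smult_carrier_vec rank_input_carrier(2)[OF _ x])
  have z: "z \<in> carrier_vec ?L"
    unfolding z_def by (rule concat_vec_rk_carrier) (rule rank_input_carrier(1)[OF _ x])
  \<comment> \<open>The rank blocks are merged into one, so that the blocks of the input match those
    of \<open>D_E\<close>.\<close>
  have input: "loop_input j x v = concat_vec (v # map (\<lambda>i. (- delta i j) \<cdot>\<^sub>v v) ?ms @ [w])"
    unfolding loop_input_def w_def
    by (simp only: concat_vec_append concat_vec_simps append_vec_vNil_right)
  have DD: "(- DeltaD \<Sigma> i) *\<^sub>v ((- delta i j) \<cdot>\<^sub>v v) = delta i j \<cdot>\<^sub>v (DeltaD \<Sigma> i *\<^sub>v v)"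
    if "i \<in> {2..l}" for i
  proof -
    have D: "- DeltaD \<Sigma> i \<in> carrier_mat p m" using Delta_carrier(4)[of i] that by simp
    have dim: "dim_vec v = dim_col (DeltaD \<Sigma> i)" using DeltaD_dims[OF that] carrier_vecD[OF v] by simp
    show ?thesis
      unfolding mult_mat_vec[OF D v] uminus_mult_mat_vec[OF dim] by (rule eq_vecI) auto
  qed
  have "sysD E *\<^sub>v loop_input j x v = concat_vec (map2 (*\<^sub>v) ?Ds (v # map (\<lambda>i. (- delta i j) \<cdot>\<^sub>v v) ?ms @ [w]))"
    unfolding sysD_envelope input append_Cons
    by (rule diag_block_mat_mult_concat_vec)
      (use carrier_matD[OF sys1_carrier(4)] DeltaD_dims carrier_vecD[OF v] carrier_vecD[OF w] in
        \<open>simp add: list_all2_append list_all2_map_same del: upt_Suc\<close>)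
  also have "map2 (*\<^sub>v) ?Ds (v # map (\<lambda>i. (- delta i j) \<cdot>\<^sub>v v) ?ms @ [w]) =
      sysD (\<Sigma> 1) *\<^sub>v v # map (\<lambda>i. delta i j \<cdot>\<^sub>v (DeltaD \<Sigma> i *\<^sub>v v)) ?ms @ [0\<^sub>v ?L]"
    using DD w by (simp add: map2_map_same zero_mat_mult_vec del: upt_Suc uminus_mult_mat_vec)
  finally have "sysC E *\<^sub>v x + sysD E *\<^sub>v loop_input j x v =
      concat_vec (sysC (\<Sigma> 1) *\<^sub>v x # map (\<lambda>i. DeltaC \<Sigma> i *\<^sub>v x) ?ms @ [z]) +
      concat_vec (sysD (\<Sigma> 1) *\<^sub>v v # map (\<lambda>i. delta i j \<cdot>\<^sub>v (DeltaD \<Sigma> i *\<^sub>v v)) ?ms @ [0\<^sub>v ?L])"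
    unfolding sysC_envelope_mult[OF x] z_def by simp
  also have "\<dots> = concat_vec (map2 (+)
      (sysC (\<Sigma> 1) *\<^sub>v x # map (\<lambda>i. DeltaC \<Sigma> i *\<^sub>v x) ?ms @ [z])
      (sysD (\<Sigma> 1) *\<^sub>v v # map (\<lambda>i. delta i j \<cdot>\<^sub>v (DeltaD \<Sigma> i *\<^sub>v v)) ?ms @ [0\<^sub>v ?L]))"
  proof (rule concat_vec_add)
    have "dim_row (DeltaC \<Sigma> i) = p" if "i \<in> {2..l}" for i
      using carrier_matD[OF Delta_carrier(3)[of i]] that by simp
    then show "list_all2 (\<lambda>v w. dim_vec v = dim_vec w)
      (sysC (\<Sigma> 1) *\<^sub>v x # map (\<lambda>i. DeltaC \<Sigma> i *\<^sub>v x) ?ms @ [z])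
      (sysD (\<Sigma> 1) *\<^sub>v v # map (\<lambda>i. delta i j \<cdot>\<^sub>v (DeltaD \<Sigma> i *\<^sub>v v)) ?ms @ [0\<^sub>v ?L])"
      using carrier_matD[OF sys1_carrier(4)] carrier_matD[OF sys1_carrier(3)] DeltaD_dims carrier_vecD[OF z]
      by (simp add: list_all2_append list_all2_map_same del: upt_Suc)
  qed
  also have "\<dots> = loop_output j x v"
    unfolding loop_output_def using right_zero_vec[OF z]
    by (simp add: map2_map_same z_def del: upt_Suc right_zero_vec)
  finally show ?thesis .
qed

section \<open>Correspondence between switched and closed-loop trajectories\<close>

lemma sysA_entries_bounded:
  obtains L :: real where "L \<ge> 0"
    "\<And>j i k. j \<in> {1..l} \<Longrightarrow> i < n \<Longrightarrow> k < n \<Longrightarrow> \<bar>sysA (\<Sigma> j) $$ (i, k)\<bar> \<le> L"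
proof
  let ?f = "\<lambda>(j, i, k). \<bar>sysA (\<Sigma> j) $$ (i, k)\<bar>" and ?I = "{1..l} \<times> {..<n} \<times> {..<n}"
  \<comment> \<open>The sum of all absolute entries over the finitely many modes is a bound
    independent of the switching.\<close>
  show "0 \<le> sum ?f ?I" by (rule sum_nonneg) auto
  fix j i k assume "j \<in> {1..l}" "i < n" "k < n"
  then show "\<bar>sysA (\<Sigma> j) $$ (i, k)\<bar> \<le> sum ?f ?I"
    using member_le_sum[of "(j, i, k)" ?I ?f] by auto
qed

text \<open>Existence: the switched state itself is a state of the closed loop, driven by
  \<open>loop_input\<close>.\<close>

lemma closed_loop_of_trajectory:
  assumes s: "\<And>t. t \<ge> 0 \<Longrightarrow> s t \<in> {1..l}" and u: "\<And>t. t \<ge> 0 \<Longrightarrow> u t \<in> carrier_vec m"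
    and x: "trajectory n (\<lambda>t. \<Sigma> (s t)) u x y"
  shows "closed_loop_output n E (\<lambda>t. fbK m p l M (s t)) (\<lambda>t. fbK0 n m l \<Sigma> (s t)) u
    (\<lambda>t. sysC E *\<^sub>v x t + sysD E *\<^sub>v loop_input (s t) (x t) (u t))"
proof -
  have car: "x t \<in> carrier_vec n" if "t \<ge> 0" for t using x that by (simp add: trajectory_def)
  have "trajectory n (\<lambda>_. E) (\<lambda>t. loop_input (s t) (x t) (u t)) x
      (\<lambda>t. sysC E *\<^sub>v x t + sysD E *\<^sub>v loop_input (s t) (x t) (u t))"
    by (rule trajectory_cong[OF x]) (simp_all only: envelope_dynamics_loop_input[OF s car u])
  \<comment> \<open>\<open>feedback_eq_loop_input\<close> with \<open>loop_input\<close> in the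
    place of \<open>uE\<close>: it is a fixed point of the loop.\<close>
  moreover have "loop_input (s t) (x t) (u t) = fbK m p l M (s t) *\<^sub>v
      (sysC E *\<^sub>v x t + sysD E *\<^sub>v loop_input (s t) (x t) (u t)) + fbK0 n m l \<Sigma> (s t) *\<^sub>v u t"
    if "t \<ge> 0" for t
    by (rule feedback_eq_loop_input[symmetric]) (use car u that loop_input_carrier in auto)
  ultimately show ?thesis unfolding closed_loop_output_def by blast
qed

text \<open>The feedback law forces \<open>uE\<close> to be \<open>loop_input\<close>, so the
  envelope state follows the modes \<open>s\<close>. These stay prescribed: they are not recomputed
  from the new output.\<close>

lemma closed_loop_imp_trajectory:
  assumes s: "\<And>t. t \<ge> 0 \<Longrightarrow> s t \<in> {1..l}" and u: "\<And>t. t \<ge> 0 \<Longrightarrow> u t \<in> carrier_vec m"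
    and cl: "closed_loop_output n E (\<lambda>t. fbK m p l M (s t)) (\<lambda>t. fbK0 n m l \<Sigma> (s t)) u yE"
  obtains x where "trajectory n (\<lambda>t. \<Sigma> (s t)) u x (\<lambda>t. fbC0 n p l \<Sigma> (s t) *\<^sub>v yE t)"
proof -
  obtain uE x where x: "trajectory n (\<lambda>_. E) uE x yE"
    and fb: "\<And>t. t \<ge> 0 \<Longrightarrow> uE t = fbK m p l M (s t) *\<^sub>v yE t + fbK0 n m l \<Sigma> (s t) *\<^sub>v u t"
    using cl unfolding closed_loop_output_def by blast
  have car: "x t \<in> carrier_vec n" and yE: "yE t = sysC E *\<^sub>v x t + sysD E *\<^sub>v uE t" if "t \<ge> 0" for t
    using x that by (simp_all add: trajectory_def)
  have uE: "uE t = loop_input (s t) (x t) (u t)" if t: "t \<ge> 0" for t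
  proof -
    have "uE t \<in> carrier_vec (l * m + rk_sum n l \<Sigma>)"
      unfolding fb[OF t] by (rule feedback_carrier)
    then show ?thesis
      using feedback_eq_loop_input[OF car[OF t] u[OF t], of "uE t" "s t", folded yE[OF t], folded fb[OF t]]
      by simp
  qed
  have "trajectory n (\<lambda>t. \<Sigma> (s t)) u x (\<lambda>t. fbC0 n p l \<Sigma> (s t) *\<^sub>v yE t)"
  proof (rule trajectory_cong[OF x])
    fix t :: real assume t: "t \<ge> 0"
    note c = s[OF t] car[OF t] u[OF t]
    show "sysA E *\<^sub>v x t + sysB E *\<^sub>v uE t = sysA (\<Sigma> (s t)) *\<^sub>v x t + sysB (\<Sigma> (s t)) *\<^sub>v u t"
      unfolding uE[OF t] by (rule envelope_dynamics_loop_input[OF c])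
    show "fbC0 n p l \<Sigma> (s t) *\<^sub>v yE t = sysC (\<Sigma> (s t)) *\<^sub>v x t + sysD (\<Sigma> (s t)) *\<^sub>v u t"
      unfolding yE[OF t] uE[OF t] envelope_output_loop_input[OF c(2,3)] by (rule fbC0_loop_output[OF c])
  qed
  then show thesis by (rule that)
qed

end

theorem proposition3p4:
  fixes n m p l :: nat
    and \<Sigma> :: "nat \<Rightarrow> state_space"
    and S M T :: "nat \<Rightarrow> real mat"
    and \<sigma> :: "real \<Rightarrow> real vec \<Rightarrow> nat"
    and s :: "real \<Rightarrow> nat"
    and u y :: "real \<Rightarrow> real vec"
  assumes "switched_system n m p l \<Sigma>"
    and "decomposition n l \<Sigma> S M T"
    and "switching_law p l \<sigma>"
    and "\<forall>t\<ge>0. u t \<in> carrier_vec m"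
    and "\<forall>t\<ge>0. y t \<in> carrier_vec p"
    and "switched_output n \<Sigma> \<sigma> u y"
    and "\<forall>t\<ge>0. s t = \<sigma> t (y t)"
    and "piecewise_constant s"
  shows "(\<exists>yE. closed_loop_output n (envelope n l \<Sigma> S T)
             (\<lambda>t. fbK m p l M (s t)) (\<lambda>t. fbK0 n m l \<Sigma> (s t)) u yE) \<and>
         (\<forall>yE. closed_loop_output n (envelope n l \<Sigma> S T)
             (\<lambda>t. fbK m p l M (s t)) (\<lambda>t. fbK0 n m l \<Sigma> (s t)) u yE \<longrightarrow>
           (\<forall>t\<ge>0. y t = fbC0 n p l \<Sigma> (s t) *\<^sub>v yE t))"
proof -
  interpret envelope_setup n m p l \<Sigma> S M T
    using assms(1,2) by unfold_locales
  have s: "s t \<in> {1..l}" if "t \<ge> 0" for t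
    using assms(3,5,7) that by (simp add: switching_law_def)
  have u: "u t \<in> carrier_vec m" if "t \<ge> 0" for t
    using assms(4) that by simp
  obtain x where "trajectory n (\<lambda>t. \<Sigma> (\<sigma> t (y t))) u x y"
    using assms(6) unfolding switched_output_def by blast
  then have x: "trajectory n (\<lambda>t. \<Sigma> (s t)) u x y"
    \<comment> \<open>The two mode functions are known to agree only for \<open>t \<ge> 0\<close>,
      hence a transfer instead of a rewrite.\<close>
    by (rule trajectory_cong) (use \<open>trajectory n _ u x y\<close> assms(7) in \<open>simp_all add: trajectory_def\<close>)
  obtain L :: real where L: "L \<ge> 0"
    "\<And>j i k. j \<in> {1..l} \<Longrightarrow> i < n \<Longrightarrow> k < n \<Longrightarrow> \<bar>sysA (\<Sigma> j) $$ (i, k)\<bar> \<le> L"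
    using sysA_entries_bounded by blast
  have "y t = fbC0 n p l \<Sigma> (s t) *\<^sub>v yE t"
    if cl: "closed_loop_output n E (\<lambda>t. fbK m p l M (s t)) (\<lambda>t. fbK0 n m l \<Sigma> (s t)) u yE"
      and t: "t \<ge> 0" for yE t
  proof -
    \<comment> \<open>The state \<open>x'\<close> comes from the closed loop and is a priori
      unrelated to \<open>x\<close>; both solve the system with modes \<open>s\<close>, so
      uniqueness identifies them and the output equation gives the claim.\<close>
    obtain x' where x': "trajectory n (\<lambda>t. \<Sigma> (s t)) u x' (\<lambda>t. fbC0 n p l \<Sigma> (s t) *\<^sub>v yE t)"
      using closed_loop_imp_trajectory[OF s u cl] by blast
    have "is_state_space n m p (\<Sigma> (s t))" if "t \<ge> 0" for t
      using sys s[OF that] by (simp add: switched_system_def)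
    then have "x t = x' t"
      by (rule trajectory_state_unique[OF x x' _ u L(1) L(2)[OF s] t])
    then show ?thesis using x x' t by (simp add: trajectory_def)
  qed
  then show ?thesis using closed_loop_of_trajectory[OF s u x] by blast
qed

end
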